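(* Let $n\geq 2$. Every bijection $f:\partial_\infty\mathbb{H}^n_{\mathbb{H}}\to\partial_\infty\mathbb{H}^n_{\mathbb{H}}$ that maps chains to chains is the restriction to $\partial_\infty\mathbb{H}^n_{\mathbb{H}}$ of an element of $\mathrm{PU}_q$.
   Context: $\mathbb{H}$ denotes Hamilton's quaternions, with conjugation $\overline{x}$, norm $\mathrm{n}(x)=x\overline{x}$ and trace $\mathrm{tr}(x)=x+\overline{x}$. Let $q(z_0,z,z_n)=-\mathrm{tr}(\overline{z_0}z_n)+\mathrm{n}(z)$ on the right $\mathbb{H}$-vector space $\mathbb{H}\times\mathbb{H}^{n-1}\times\mathbb{H}$, where $\mathrm{n}(z)=\sum_p\mathrm{n}(z_p)$. In the right quaternionic projective space $\mathbb{P}^n_{\rm r}(\mathbb{H})$, $\mathbb{H}^n_{\mathbb{H}}$ is the set of points where $q<0$ and $\partial_\infty\mathbb{H}^n_{\mathbb{H}}$ the set of points where $q=0$. $\mathrm{U}_q=\{g\in\mathrm{GL}_{n+1}(\mathbb{H}):q\circ g=q\}$ and $\mathrm{PU}_q=\mathrm{U}_q/\{\pm I_{n+1}\}$ acts on $\mathbb{P}^n_{\rm r}(\mathbb{H})$ preserving $\partial_\infty\mathbb{H}^n_{\mathbb{H}}$. A chain is the intersection with $\partial_\infty\mathbb{H}^n_{\mathbb{H}}$ of a quaternionic projective line of $\mathbb{P}^n_{\rm r}(\mathbb{H})$ meeting $\mathbb{H}^n_{\mathbb{H}}$; "$f$ maps chains to chains" means that $f(C)$ is a chain for every chain $C$.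 *)

theory Defs
  imports "HOL-Analysis.Analysis" "HOL-Algebra.Coset"
begin

section \<open>Hamilton's quaternions\<close>

datatype quat = Quat (qRe: real) (qI: real) (qJ: real) (qK: real)

lemma quat_eq_iff:
  "x = y \<longleftrightarrow> qRe x = qRe y \<and> qI x = qI y \<and> qJ x = qJ y \<and> qK x = qK y"
  by (auto intro: quat.expand)

instantiation quat :: ring_1
begin

definition "0 = Quat 0 0 0 0"
definition "1 = Quat 1 0 0 0"
definition "x + y = Quat (qRe x + qRe y) (qI x + qI y) (qJ x + qJ y) (qK x + qK y)"
definition "- x = Quat (- qRe x) (- qI x) (- qJ x) (- qK x)"
definition "x - y = Quat (qRe x - qRe y) (qI x - qI y) (qJ x - qJ y) (qK x - qK y)"
definition "x * y = Quat
  (qRe x * qRe y - qI x * qI y - qJ x * qJ y - qK x * qK y)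
  (qRe x * qI y + qI x * qRe y + qJ x * qK y - qK x * qJ y)
  (qRe x * qJ y - qI x * qK y + qJ x * qRe y + qK x * qI y)
  (qRe x * qK y + qI x * qJ y - qJ x * qI y + qK x * qRe y)"

instance
  by standard (simp_all add: quat_eq_iff zero_quat_def one_quat_def plus_quat_def
    uminus_quat_def minus_quat_def times_quat_def algebra_simps)

end

lemmas quat_arith_defs = zero_quat_def one_quat_def plus_quat_def uminus_quat_def
  minus_quat_def times_quat_def

definition qcnj :: "quat \<Rightarrow> quat" where
  "qcnj x = Quat (qRe x) (- qI x) (- qJ x) (- qK x)"

text \<open>The quaternions \<open>x \<cdot> qcnj x\<close> and \<open>x + qcnj x\<close> are real; \<open>qnorm\<close> and \<open>qtr\<close>
  are these real numbers.\<close>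

definition qnorm :: "quat \<Rightarrow> real" where
  "qnorm x = qRe (x * qcnj x)"

definition qtr :: "quat \<Rightarrow> real" where
  "qtr x = qRe (x + qcnj x)"

lemma mult_qcnj: "x * qcnj x = Quat (qnorm x) 0 0 0"
  by (simp add: qnorm_def qcnj_def quat_arith_defs)

lemma add_qcnj: "x + qcnj x = Quat (qtr x) 0 0 0"
  by (simp add: qtr_def qcnj_def quat_arith_defs)

lemma qnorm_sum_squares: "qnorm x = (qRe x)\<^sup>2 + (qI x)\<^sup>2 + (qJ x)\<^sup>2 + (qK x)\<^sup>2"
  by (simp add: qnorm_def qcnj_def quat_arith_defs power2_eq_square)

lemma qnorm_eq_0_iff: "qnorm x = 0 \<longleftrightarrow> x = 0"
proof
  assume "qnorm x = 0"
  moreover have "0 \<le> (qRe x)\<^sup>2" "0 \<le> (qI x)\<^sup>2" "0 \<le> (qJ x)\<^sup>2" "0 \<le> (qK x)\<^sup>2" by simp_all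
  ultimately have "(qRe x)\<^sup>2 = 0" "(qI x)\<^sup>2 = 0" "(qJ x)\<^sup>2 = 0" "(qK x)\<^sup>2 = 0"
    unfolding qnorm_sum_squares by linarith+
  then show "x = 0" by (simp add: quat_eq_iff zero_quat_def)
qed (simp add: qnorm_sum_squares zero_quat_def)

instantiation quat :: division_ring
begin

definition "inverse x = Quat (qRe x / qnorm x) (- qI x / qnorm x) (- qJ x / qnorm x) (- qK x / qnorm x)"
definition "x div y = x * inverse (y :: quat)"

instance
proof
  fix x y :: quat
  assume "x \<noteq> 0"
  then have nz: "qnorm x \<noteq> 0" by (simp add: qnorm_eq_0_iff)
  have [simp]: "qRe x * qRe x + qI x * qI x + qJ x * qJ x + qK x * qK x = qnorm x"
    by (simp add: qnorm_sum_squares power2_eq_square)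
  show "inverse x * x = 1" "x * inverse x = 1"
    using nz by (simp_all add: inverse_quat_def quat_arith_defs mult.commute
        flip: add_divide_distrib diff_divide_distrib)
next
  show "x div y = x * inverse y" for x y :: quat by (fact divide_quat_def)
  show "inverse (0 :: quat) = 0" by (simp add: inverse_quat_def zero_quat_def)
qed

end


section \<open>The right vector space and the form \<open>q\<close>\<close>

text \<open>The space \<open>\<H> \<times> \<H>\<^sup>n\<^sup>-\<^sup>1 \<times> \<H>\<close> is \<open>quat ^ 'm coord\<close>, where \<open>n - 1 = CARD('m)\<close>. As types are
  nonempty, the finite types \<open>'m\<close> correspond exactly to the integers \<open>n \<ge> 2\<close>.\<close>

datatype 'm coord = First | Mid 'm | Last

instance coord :: (finite) finite
proof
  have "(UNIV :: 'a coord set) = insert First (insert Last (range Mid))"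
    by (auto intro: coord.exhaust)
  then show "finite (UNIV :: 'a coord set)"
    by (metis finite finite.insertI finite_imageI)
qed

type_synonym 'm hvec = "quat ^ 'm coord"
type_synonym 'm hmat = "quat ^ 'm coord ^ 'm coord"

definition rscale :: "'m::finite hvec \<Rightarrow> quat \<Rightarrow> 'm hvec" where
  "rscale v a = (\<chi> i. v $ i * a)"

definition qform :: "'m::finite hvec \<Rightarrow> real" where
  "qform v = - qtr (qcnj (v $ First) * v $ Last) + (\<Sum>p\<in>UNIV. qnorm (v $ Mid p))"

lemma qform_rscale: "qform (rscale v a) = qnorm a * qform v"
proof -
  have "qtr (qcnj (x * a) * (y * a)) = qnorm a * qtr (qcnj x * y)" for x y
    by (simp add: qtr_def qnorm_def qcnj_def quat_arith_defs algebra_simps)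
  moreover have "qnorm (x * a) = qnorm a * qnorm x" for x
    by (simp add: qnorm_def qcnj_def quat_arith_defs algebra_simps)
  ultimately show ?thesis
    by (simp add: qform_def rscale_def sum_distrib_left right_diff_distrib)
qed


section \<open>Right projective space, hyperbolic space, boundary, chains\<close>

text \<open>A point of projective space is a one-dimensional right subspace.\<close>

definition rline :: "'m::finite hvec \<Rightarrow> 'm hvec set" where
  "rline v = range (rscale v)"

definition proj_space :: "'m::finite hvec set set" where
  "proj_space = {rline v | v. v \<noteq> 0}"

definition hyp_space :: "'m::finite hvec set set" where
  "hyp_space = {rline v | v. v \<noteq> 0 \<and> qform v < 0}"

definition hyp_boundary :: "'m::finite hvec set set" where
  "hyp_boundary = {rline v | v. v \<noteq> 0 \<and> qform v = 0}"

definition right_indep :: "'m::finite hvec \<Rightarrow> 'm hvec \<Rightarrow> bool" where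
  "right_indep u v \<longleftrightarrow> (\<forall>a b. rscale u a + rscale v b = 0 \<longrightarrow> a = 0 \<and> b = 0)"

definition right_span2 :: "'m::finite hvec \<Rightarrow> 'm hvec \<Rightarrow> 'm hvec set" where
  "right_span2 u v = {rscale u a + rscale v b | a b. True}"

text \<open>A projective line consists of the points contained in a two-dimensional right subspace.\<close>

definition proj_line :: "'m::finite hvec set set \<Rightarrow> bool" where
  "proj_line L \<longleftrightarrow>
    (\<exists>u v. right_indep u v \<and> L = {x \<in> proj_space. x \<subseteq> right_span2 u v})"

definition chain :: "'m::finite hvec set set \<Rightarrow> bool" where
  "chain C \<longleftrightarrow> (\<exists>L. proj_line L \<and> L \<inter> hyp_space \<noteq> {} \<and> C = L \<inter> hyp_boundary)"


section \<open>The groups \<open>U\<^sub>q\<close> and \<open>PU\<^sub>q\<close>\<close>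

definition U_q :: "'m::finite hmat monoid" where
  "U_q = \<lparr>carrier = {g. invertible g \<and> qform \<circ> (*v) g = qform}, mult = (**), one = mat 1\<rparr>"

definition PU_q :: "'m::finite hmat set monoid" where
  "PU_q = U_q Mod {mat 1, - mat 1}"

definition proj_act :: "'m::finite hmat \<Rightarrow> 'm hvec set \<Rightarrow> 'm hvec set" where
  "proj_act g x = (*v) g ` x"

text \<open>An element of \<open>PU\<^sub>q\<close> is a coset; it acts by the common action of its representatives.\<close>

definition PU_act :: "'m::finite hmat set \<Rightarrow> 'm hvec set \<Rightarrow> 'm hvec set" where
  "PU_act \<gamma> x = (THE y. \<forall>g\<in>\<gamma>. y = proj_act g x)"

lemma matrix_neg_left: "(- A) ** B = - (A ** (B :: 'a::ring_1 ^ 'n ^ 'n))"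
  by (simp add: matrix_matrix_mult_def vec_eq_iff sum_negf)

lemma matrix_neg_right: "A ** (- B) = - (A ** (B :: 'a::ring_1 ^ 'n ^ 'n))"
  by (simp add: matrix_matrix_mult_def vec_eq_iff sum_negf)

lemma matrix_vector_neg: "(- A) *v v = - (A *v (v :: 'a::ring_1 ^ 'n))"
  by (simp add: matrix_vector_mult_def vec_eq_iff sum_negf)

lemma matrix_vector_rscale: "g *v rscale v a = rscale (g *v v) a"
  by (simp add: rscale_def matrix_vector_mult_def vec_eq_iff sum_distrib_right mult.assoc)

lemma rscale_minus_one: "rscale v (- 1) = - v"
  by (simp add: rscale_def vec_eq_iff)

lemma group_U_q: "group (U_q :: 'm::finite hmat monoid)"
proof (rule groupI)
  fix g h :: "'m hmat"
  assume "g \<in> carrier U_q" "h \<in> carrier U_q"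
  then show "g \<otimes>\<^bsub>U_q\<^esub> h \<in> carrier U_q"
    by (auto simp: U_q_def invertible_mult fun_eq_iff simp flip: matrix_vector_mul_assoc)
next
  show "\<one>\<^bsub>U_q\<^esub> \<in> carrier (U_q :: 'm hmat monoid)"
    by (auto simp: U_q_def invertible_def fun_eq_iff intro!: exI[of _ "mat 1"])
next
  fix g :: "'m hmat"
  assume g: "g \<in> carrier U_q"
  then obtain h where h: "g ** h = mat 1" "h ** g = mat 1"
    by (auto simp: U_q_def invertible_def)
  have "qform (h *v v) = qform v" for v
  proof -
    have "qform (g *v (h *v v)) = qform (h *v v)"
      using g by (simp add: U_q_def fun_eq_iff)
    then show ?thesis by (simp add: matrix_vector_mul_assoc h)
  qed
  then show "\<exists>h\<in>carrier U_q. h \<otimes>\<^bsub>U_q\<^esub> g = \<one>\<^bsub>U_q\<^esub>"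
    using h by (auto simp: U_q_def invertible_def fun_eq_iff intro!: bexI[of _ h])
qed (auto simp: U_q_def matrix_mul_assoc)

lemma normal_pm_one: "normal {mat 1, - mat 1} (U_q :: 'm::finite hmat monoid)"
proof -
  interpret group "U_q :: 'm hmat monoid" by (rule group_U_q)
  have one: "mat 1 \<in> carrier (U_q :: 'm hmat monoid)"
    using one_closed by (simp add: U_q_def)
  have "qform (- v) = qform v" for v :: "'m hvec"
  proof -
    have "qnorm (- 1) = 1" by (simp add: qnorm_sum_squares quat_arith_defs)
    then show ?thesis using qform_rscale[of v "- 1"] by (simp add: rscale_minus_one)
  qed
  then have neg: "- mat 1 \<in> carrier (U_q :: 'm hmat monoid)"
    by (auto simp: U_q_def invertible_def fun_eq_iff matrix_vector_neg matrix_neg_left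
        intro!: exI[of _ "- mat 1"])
  have negneg: "- mat 1 \<otimes>\<^bsub>U_q\<^esub> - mat 1 = (\<one>\<^bsub>U_q\<^esub> :: 'm hmat)"
    by (simp add: U_q_def matrix_neg_left)
  then have inv_neg: "inv\<^bsub>U_q\<^esub> (- mat 1) = (- mat 1 :: 'm hmat)"
    using neg by (simp add: inv_equality)
  have inv_one_mat: "inv\<^bsub>U_q\<^esub> (mat 1) = (mat 1 :: 'm hmat)"
    using inv_one by (simp add: U_q_def)
  have sub: "subgroup {mat 1, - mat 1} (U_q :: 'm hmat monoid)"
    using one neg inv_neg inv_one_mat
    by (intro subgroupI) (auto simp: U_q_def matrix_neg_left)
  show ?thesis
    using sub by (rule normalI)
      (auto simp: r_coset_def l_coset_def U_q_def matrix_neg_left matrix_neg_right)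
qed

lemma PU_act_coset:
  fixes x :: "'m::finite hvec set"
  assumes "x \<in> proj_space"
  shows "PU_act ({mat 1, - mat 1} #>\<^bsub>U_q\<^esub> g) x = proj_act g x"
proof -
  obtain v where x: "x = rline v" using assms by (auto simp: proj_space_def)
  have "proj_act h x = rline (h *v v)" for h
    by (simp add: proj_act_def x rline_def image_image matrix_vector_rscale)
  moreover have "rline (- w) = rline w" for w :: "'m hvec"
  proof -
    have "rscale (- w) a = rscale w (- a)" "rscale w a = rscale (- w) (- a)" for a
      by (simp_all add: rscale_def vec_eq_iff)
    then show ?thesis unfolding rline_def by (blast intro: rangeI)
  qed
  ultimately have "proj_act (- g) x = proj_act g x"
    by (simp add: matrix_vector_neg)
  then show ?thesis
    by (auto simp: PU_act_def r_coset_def U_q_def matrix_neg_left)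
qed

end

theory Submission
  imports Defs
begin

text \<open>
  After composing with elements of \<open>U\<^sub>q\<close>, the map \<open>f\<close> fixes \<open>\<infinity> = (0, 0, 1)\<close> and \<open>(1, 0, 0)\<close>. The
  other boundary points are \<open>(1, \<zeta>, u)\<close> with \<open>tr u = n(\<zeta>)\<close>; since chains through \<open>\<infinity>\<close> are the
  fibres of \<open>(\<zeta>, u) \<mapsto> \<zeta>\<close>, \<open>f\<close> has the form \<open>(\<zeta>, u) \<mapsto> (F \<zeta>, G (\<zeta>, u))\<close>. The other chains project onto
  the 3-spheres in quaternionic affine lines, so \<open>F\<close> maps such spheres to such spheres. Tangency
  of spheres determines hyperplanes, antipodes, lines and centres, so \<open>F\<close> preserves midpoints in
  each quaternionic line; being locally bounded it is real linear, and
  \<open>F (\<delta> b) = F \<delta> \<cdot> \<phi>\<^sub>\<delta> b\<close> with a linear isometry \<open>\<phi>\<^sub>\<delta>\<close> fixing 1.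

  The centre of the shadow of the chain through \<open>(\<zeta>, u)\<close> and \<open>(\<zeta> + \<delta>, w)\<close> is given by the quaternion
  \<open>w - u - \<langle>\<zeta>, \<delta>\<rangle>\<close>. Comparing centres,
  \<open>w' - u' - \<langle>F \<zeta>, F \<delta>\<rangle> = (n(F \<delta>) / n(\<delta>)) \<phi>\<^sub>\<delta> (w - u - \<langle>\<zeta>, \<delta>\<rangle>)\<close>.
  Varying \<open>u\<close> alone shows that \<open>n(F \<delta>) / n(\<delta>) = k\<^sup>2\<close> and \<open>\<phi>\<^sub>\<delta> = \<phi>\<close> do not depend on \<open>\<delta>\<close>. Hence
  \<open>G (\<zeta>, u) = k\<^sup>2 \<phi> u\<close> and \<open>\<phi>\<close> is multiplicative, so \<open>\<phi>\<close> is conjugation by some \<open>p\<close>, and \<open>f\<close> is induced by the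
  right linear map \<open>(z\<^sub>0, z, z\<^sub>n) \<mapsto> (p z\<^sub>0, F(z) p, k\<^sup>2 p z\<^sub>n)\<close>, a multiple of an element of \<open>U\<^sub>q\<close>.
\<close>

section \<open>Bijections preserving spheres\<close>

definition is_sphere :: "'a::real_inner set \<Rightarrow> bool" where
  "is_sphere S \<longleftrightarrow> (\<exists>c r. 0 < r \<and> S = sphere c r)"

text \<open>The tangent hyperplane at \<open>p\<close>, expressed by incidences of spheres: the spheres touching \<open>S\<close> at
  \<open>p\<close> cover exactly its complement outside \<open>S\<close>, except for \<open>p\<close> itself.\<close>

definition tangent_at :: "'a::real_inner set \<Rightarrow> 'a \<Rightarrow> 'a set" where
  "tangent_at S p = insert p {x. x \<notin> S \<and> \<not> (\<exists>S'. is_sphere S' \<and> S' \<inter> S = {p} \<and> x \<in> S')}"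

definition is_hyperplane :: "'a::real_inner set \<Rightarrow> bool" where
  "is_hyperplane H \<longleftrightarrow> (\<exists>p n. n \<noteq> 0 \<and> H = {x. (x - p) \<bullet> n = 0})"

text \<open>Cutting lines out by hyperplanes makes a bijection that preserves hyperplanes in both
  directions preserve lines as well. For \<open>p = q\<close> the result is the single point
  \<open>p\<close>.\<close>

definition line_thru :: "'a::real_inner \<Rightarrow> 'a \<Rightarrow> 'a set" where
  "line_thru p q = \<Inter> {H. is_hyperplane H \<and> p \<in> H \<and> q \<in> H}"

section \<open>Tangency, lines and antipodes expressed by incidences of spheres\<close>

lemma mem_sphere_inner: "0 \<le> r \<Longrightarrow> x \<in> sphere c r \<longleftrightarrow> (x - c) \<bullet> (x - c) = r\<^sup>2"
  for x :: "'a::real_inner"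
  by (simp add: dist_norm norm_minus_commute[of c] norm_eq_square)

text \<open>Expanding the squared distance to \<open>c\<close> around a known point \<open>p\<close>
  eliminates the radius, so the equations of two spheres through \<open>p\<close> differ only in a
  linear term.\<close>

lemma mem_sphere_based:
  fixes p :: "'a::real_inner"
  assumes "p \<in> sphere c r"
  shows "y \<in> sphere c r \<longleftrightarrow> (y - p) \<bullet> (y - p) + 2 * ((y - p) \<bullet> (p - c)) = 0"
proof -
  have r: "0 \<le> r" using assms by auto
  have p: "(p - c) \<bullet> (p - c) = r\<^sup>2" using assms mem_sphere_inner[OF r] by blast
  have "(y - c) \<bullet> (y - c) = ((y - p) + (p - c)) \<bullet> ((y - p) + (p - c))" by simp
  also have "\<dots> = (y - p) \<bullet> (y - p) + 2 * ((y - p) \<bullet> (p - c)) + r\<^sup>2"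
    unfolding p[symmetric] by (simp only: inner_add_left inner_add_right) (simp add: inner_commute)
  finally show ?thesis using mem_sphere_inner[OF r, of y c] by simp
qed

text \<open>A point off the sphere and off the hyperplane lies on a touching sphere centred on the
  line through \<open>c\<close> and \<open>p\<close>. Conversely, a sphere meeting the given one
  only in \<open>p\<close> has its centre on that line, so it meets the hyperplane only in
  \<open>p\<close>.\<close>

lemma tangent_at_sphere:
  fixes p :: "'a::real_inner"
  assumes r: "0 < r" and p: "p \<in> sphere c r"
  shows "tangent_at (sphere c r) p = {x. (x - p) \<bullet> (p - c) = 0}"
proof -
  define n where "n = p - c"
  have nn: "n \<bullet> n = r\<^sup>2" "n \<noteq> 0"
    using p r mem_sphere_inner[of r p c] by (auto simp: n_def)
  have S: "y \<in> sphere c r \<longleftrightarrow> (y - p) \<bullet> (y - p) + 2 * ((y - p) \<bullet> n) = 0" for y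
    using mem_sphere_based[OF p] by (simp add: n_def)
  have off: "\<exists>S'. is_sphere S' \<and> S' \<inter> sphere c r = {p} \<and> x \<in> S'"
    if x: "x \<notin> sphere c r" "(x - p) \<bullet> n \<noteq> 0" for x
  proof -
    \<comment> \<open>The sphere about \<open>p + t *\<^sub>R n\<close> through \<open>p\<close>
      contains \<open>x\<close> exactly for this \<open>t\<close>; the value -1 would reproduce the
      given sphere.\<close>
    define t where "t = (x - p) \<bullet> (x - p) / (2 * ((x - p) \<bullet> n))"
    have xt: "(x - p) \<bullet> (x - p) = 2 * t * ((x - p) \<bullet> n)" using x(2) by (simp add: t_def)
    have "x \<noteq> p" using x(2) by auto
    then have t0: "t \<noteq> 0" using xt by auto
    have t1: "t \<noteq> -1" using xt x(1) S[of x] by auto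
    define c' where "c' = p + t *\<^sub>R n"
    have p': "p \<in> sphere c' (norm (t *\<^sub>R n))" by (simp add: c'_def dist_norm)
    have S': "y \<in> sphere c' (norm (t *\<^sub>R n)) \<longleftrightarrow> (y - p) \<bullet> (y - p) = 2 * t * ((y - p) \<bullet> n)" for y
      using mem_sphere_based[OF p', of y] by (simp add: c'_def algebra_simps)
    have "is_sphere (sphere c' (norm (t *\<^sub>R n)))"
      unfolding is_sphere_def using t0 nn(2) by (intro exI conjI) (auto simp: c'_def)
    moreover have "y = p" if "y \<in> sphere c' (norm (t *\<^sub>R n))" "y \<in> sphere c r" for y
    proof -
      have "2 * (1 + t) * ((y - p) \<bullet> n) = 0"
        using that S[of y] S'[of y] by (simp add: algebra_simps)
      then have "(y - p) \<bullet> n = 0" using t1 by auto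
      then show ?thesis using that(2) S[of y] by simp
    qed
    ultimately show ?thesis using p p' S'[of x] xt by blast
  qed
  have on: "x = p" if x: "(x - p) \<bullet> n = 0" and S'': "is_sphere S'" "S' \<inter> sphere c r = {p}" "x \<in> S'"
    for x S'
  proof -
    obtain c' r' where r': "0 < r'" and S'eq: "S' = sphere c' r'" using S''(1) by (auto simp: is_sphere_def)
    have p': "p \<in> sphere c' r'" using S''(2) S'eq by blast
    have S': "y \<in> S' \<longleftrightarrow> (y - p) \<bullet> (y - p) + 2 * ((y - p) \<bullet> (p - c')) = 0" for y
      unfolding S'eq by (rule mem_sphere_based[OF p'])
    define d where "d = c' - c"
    have pc': "p - c' = n - d" by (simp add: n_def d_def)
    \<comment> \<open>The mirror image of \<open>p\<close> in the line of centres lies on both spheres.\<close>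
    define m where "m = (2 * ((n \<bullet> d) / (d \<bullet> d))) *\<^sub>R d - 2 *\<^sub>R n"
    \<comment> \<open>For concentric spheres, division by zero yields
      \<open>m = - 2 *\<^sub>R n\<close>, which leads to the antipode of \<open>p\<close>; the same
      formulas then cover this case.\<close>
    have md: "m \<bullet> d = 0"
      by (cases "d = 0") (simp_all add: m_def inner_diff_left)
    have mm: "m \<bullet> m = - 2 * (m \<bullet> n)"
    proof -
      have "m \<bullet> m = m \<bullet> ((2 * ((n \<bullet> d) / (d \<bullet> d))) *\<^sub>R d - 2 *\<^sub>R n)" by (simp only: m_def)
      then show ?thesis using md by (simp add: inner_diff_right)
    qed
    have "p + m \<in> sphere c r" using S[of "p + m"] mm by simp
    moreover have "p + m \<in> S'" using S'[of "p + m"] mm md by (simp add: pc' inner_diff_right)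
    ultimately have "p + m = p" using S''(2) by blast
    then have "2 *\<^sub>R (((n \<bullet> d) / (d \<bullet> d)) *\<^sub>R d) = 2 *\<^sub>R n" by (simp add: m_def)
    then have n: "n = ((n \<bullet> d) / (d \<bullet> d)) *\<^sub>R d"
      unfolding scaleR_cancel_left by simp
    define s where "s = (n \<bullet> d) / (d \<bullet> d)"
    have ns: "n = s *\<^sub>R d" unfolding s_def by (rule n)
    moreover have "s \<noteq> 0" using ns nn(2) by fastforce
    ultimately have "(x - p) \<bullet> d = 0" using x by simp
    then show "x = p" using S''(3) S'[of x] x by (simp add: pc' inner_diff_right[of _ n d])
  qed
  have "x \<in> tangent_at (sphere c r) p \<longleftrightarrow> (x - p) \<bullet> n = 0" for x
  proof
    assume "x \<in> tangent_at (sphere c r) p"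
    then show "(x - p) \<bullet> n = 0" using off[of x] by (auto simp: tangent_at_def)
  next
    assume x: "(x - p) \<bullet> n = 0"
    show "x \<in> tangent_at (sphere c r) p"
    proof (cases "x = p")
      case False
      then have "x \<notin> sphere c r" using S[of x] x by simp
      then show ?thesis using on[OF x] False by (auto simp: tangent_at_def)
    qed (simp add: tangent_at_def)
  qed
  then show ?thesis by (auto simp: n_def)
qed

text \<open>Hyperplanes thereby become definable from the family of spheres: given a point and a
  normal, take the sphere through the point whose radius vector there is the normal.\<close>

lemma is_hyperplane_iff_tangent:
  "is_hyperplane H \<longleftrightarrow> (\<exists>S p. is_sphere S \<and> p \<in> S \<and> H = tangent_at S p)"
proof
  assume "is_hyperplane H"
  then obtain p n where n: "n \<noteq> 0" "H = {x. (x - p) \<bullet> n = 0}" by (auto simp: is_hyperplane_def)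
  have p: "p \<in> sphere (p - n) (norm n)" by (simp add: dist_norm)
  have "H = tangent_at (sphere (p - n) (norm n)) p"
    using tangent_at_sphere[OF _ p] n by simp
  then show "\<exists>S p. is_sphere S \<and> p \<in> S \<and> H = tangent_at S p"
    using p n(1) unfolding is_sphere_def by (intro exI conjI) auto
next
  assume "\<exists>S p. is_sphere S \<and> p \<in> S \<and> H = tangent_at S p"
  then obtain c r p where r: "0 < r" "p \<in> sphere c r" "H = tangent_at (sphere c r) p"
    by (auto simp: is_sphere_def)
  moreover have "p - c \<noteq> 0" using r by auto
  ultimately show "is_hyperplane H"
    unfolding is_hyperplane_def using tangent_at_sphere by blast
qed

text \<open>If \<open>x\<close> were off the line, the component of \<open>x - p\<close> orthogonal
  to \<open>q - p\<close> would be the normal of a hyperplane containing \<open>p\<close> and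
  \<open>q\<close> but not \<open>x\<close>.\<close>

lemma mem_line_thru: "x \<in> line_thru p q \<longleftrightarrow> (\<exists>t. x = p + t *\<^sub>R (q - p))"
proof
  assume x: "x \<in> line_thru p q"
  define d where "d = q - p"
  define t where "t = ((x - p) \<bullet> d) / (d \<bullet> d)"
  define n where "n = (x - p) - t *\<^sub>R d"
  have nd: "n \<bullet> d = 0" by (cases "d = 0") (simp_all add: n_def t_def inner_diff_left)
  have "n = 0"
  proof (rule ccontr)
    assume "n \<noteq> 0"
    then have "is_hyperplane {y. (y - p) \<bullet> n = 0}" by (auto simp: is_hyperplane_def)
    moreover have "(q - p) \<bullet> n = 0" using nd by (simp add: d_def inner_commute)
    ultimately have "(x - p) \<bullet> n = 0" using x by (auto simp: line_thru_def)
    then have "n \<bullet> n = 0" using nd by (simp add: n_def inner_diff_left inner_commute)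
    with \<open>n \<noteq> 0\<close> show False by simp
  qed
  then show "\<exists>t. x = p + t *\<^sub>R (q - p)" by (auto simp: n_def d_def intro!: exI[of _ t] simp: algebra_simps)
next
  assume "\<exists>t. x = p + t *\<^sub>R (q - p)"
  then obtain t where x: "x = p + t *\<^sub>R (q - p)" by blast
  show "x \<in> line_thru p q"
    unfolding line_thru_def is_hyperplane_def
  proof clarsimp
    fix p' n assume "(p - p') \<bullet> n = 0" "(q - p') \<bullet> n = 0"
    moreover have "x - p' = (p - p') + t *\<^sub>R ((q - p') - (p - p'))" by (simp add: x)
    ultimately show "(x - p') \<bullet> n = 0" by (simp only: inner_add_left inner_diff_left inner_scaleR_left) simp
  qed
qed

text \<open>Tangent hyperplanes at antipodes are parallel and distinct. Otherwise
  \<open>n + n'\<close> is nonzero, and adding a suitable multiple of it to \<open>c\<close> gives a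
  point of both.\<close>

lemma antipodal_iff_tangents_disjoint:
  fixes p :: "'a::real_inner"
  assumes r: "0 < r" and p: "p \<in> sphere c r" and p': "p' \<in> sphere c r" and ne: "p \<noteq> p'"
  shows "tangent_at (sphere c r) p \<inter> tangent_at (sphere c r) p' = {} \<longleftrightarrow> p + p' = 2 *\<^sub>R c"
proof -
  define n where "n = p - c"
  define n' where "n' = p' - c"
  have nn: "n \<bullet> n = r\<^sup>2" "n' \<bullet> n' = r\<^sup>2"
    using p p' r mem_sphere_inner[of r _ c] by (auto simp: n_def n'_def)
  have pn: "p = c + n" "p' = c + n'" by (simp_all add: n_def n'_def)
  have T: "tangent_at (sphere c r) p = {x. (x - p) \<bullet> n = 0}"
    "tangent_at (sphere c r) p' = {x. (x - p') \<bullet> n' = 0}"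
    using tangent_at_sphere[OF r p] tangent_at_sphere[OF r p'] by (simp_all add: n_def n'_def)
  have anti: "p + p' = 2 *\<^sub>R c \<longleftrightarrow> n + n' = 0"
    by (simp add: pn scaleR_2 algebra_simps)
  show ?thesis unfolding anti
  proof
    assume dis: "tangent_at (sphere c r) p \<inter> tangent_at (sphere c r) p' = {}"
    show "n + n' = 0"
    proof (rule ccontr)
      assume "n + n' \<noteq> 0"
      then have "(n + n') \<bullet> (n + n') \<noteq> 0" by simp
      then have k: "r\<^sup>2 + n \<bullet> n' \<noteq> 0" using nn by (simp add: inner_add_left inner_add_right inner_commute)
      define x where "x = c + (r\<^sup>2 / (r\<^sup>2 + n \<bullet> n')) *\<^sub>R (n + n')"
      have "(x - p) \<bullet> n = 0"
        using k by (simp add: x_def pn inner_add_left inner_diff_left nn inner_commute[of n' n])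
      moreover have "(x - p') \<bullet> n' = 0"
        using k by (simp add: x_def pn inner_add_left inner_diff_left nn add.commute)
      ultimately show False using dis T by blast
    qed
  next
    assume "n + n' = 0"
    then have n': "n' = - n" by (simp add: add_eq_0_iff2)
    have False if "(x - p) \<bullet> n = 0" "(x - p') \<bullet> n' = 0" for x
    proof -
      have "(x - c) \<bullet> n = r\<^sup>2" "(x - c) \<bullet> n = - r\<^sup>2"
        using that nn by (simp_all add: pn n' inner_diff_left inner_add_left)
      then show False using r by simp
    qed
    then show "tangent_at (sphere c r) p \<inter> tangent_at (sphere c r) p' = {}"
      using T by blast
  qed
qed

text \<open>The assumption on spheres is an equivalence so that it passes to the inverse map, which
  \<open>line_image\<close> relies on.\<close>

locale sphere_bij =
  fixes \<psi> :: "'a::real_inner \<Rightarrow> 'a"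
  assumes bij: "bij \<psi>"
    and sphere_image: "is_sphere (\<psi> ` S) \<longleftrightarrow> is_sphere S"
begin

lemma sphere_bij_inv: "sphere_bij (inv_into UNIV \<psi>)"
proof
  show "bij (inv_into UNIV \<psi>)" using bij by (rule bij_imp_bij_inv)
  show "is_sphere (inv_into UNIV \<psi> ` S) = is_sphere S" for S
    using sphere_image[of "inv_into UNIV \<psi> ` S"] bij by (simp add: image_f_inv_f bij_is_surj)
qed

text \<open>\<open>tangent_at\<close> is built from membership, intersections and
  \<open>is_sphere\<close> alone, and \<open>\<psi>\<close> transports all three.\<close>

lemma tangent_image: "\<psi> ` tangent_at S p = tangent_at (\<psi> ` S) (\<psi> p)"
proof -
  have inj: "inj \<psi>" and surj: "surj \<psi>" using bij by (auto simp: bij_def)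
  have ex: "(\<exists>S'. is_sphere S' \<and> S' \<inter> \<psi> ` S = {\<psi> p} \<and> \<psi> x \<in> S') \<longleftrightarrow>
    (\<exists>S'. is_sphere S' \<and> S' \<inter> S = {p} \<and> x \<in> S')" for x
  proof
    assume "\<exists>S'. is_sphere S' \<and> S' \<inter> \<psi> ` S = {\<psi> p} \<and> \<psi> x \<in> S'"
    then obtain S' where S': "is_sphere S'" "S' \<inter> \<psi> ` S = {\<psi> p}" "\<psi> x \<in> S'" by blast
    define R where "R = \<psi> -` S'"
    have R: "S' = \<psi> ` R" using surj by (simp add: R_def surj_image_vimage_eq)
    have "\<psi> ` (R \<inter> S) = \<psi> ` {p}" using S'(2) R inj by (simp add: image_Int)
    then have "R \<inter> S = {p}" using inj by (simp add: inj_image_eq_iff del: image_insert)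
    moreover have "is_sphere R" using S'(1) sphere_image[of R] unfolding R[symmetric] by simp
    moreover have "x \<in> R" using S'(3) by (simp add: R_def)
    ultimately show "\<exists>S'. is_sphere S' \<and> S' \<inter> S = {p} \<and> x \<in> S'" by blast
  next
    assume "\<exists>S'. is_sphere S' \<and> S' \<inter> S = {p} \<and> x \<in> S'"
    then obtain S' where S': "is_sphere S'" "S' \<inter> S = {p}" "x \<in> S'" by blast
    then have "\<psi> ` S' \<inter> \<psi> ` S = {\<psi> p}" using inj by (metis image_Int image_empty image_insert)
    then show "\<exists>S'. is_sphere S' \<and> S' \<inter> \<psi> ` S = {\<psi> p} \<and> \<psi> x \<in> S'"
      using S' sphere_image by blast
  qed
  have "y \<in> \<psi> ` tangent_at S p \<longleftrightarrow> y \<in> tangent_at (\<psi> ` S) (\<psi> p)" for y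
  proof -
    obtain x where y: "y = \<psi> x" using surj by blast
    have "\<psi> x \<in> \<psi> ` tangent_at S p \<longleftrightarrow> x \<in> tangent_at S p"
      using inj by (rule inj_image_mem_iff)
    also have "\<dots> \<longleftrightarrow> \<psi> x \<in> tangent_at (\<psi> ` S) (\<psi> p)"
      unfolding tangent_at_def insert_iff mem_Collect_eq ex
      using inj by (simp only: inj_image_mem_iff inj_eq)
    finally show ?thesis unfolding y .
  qed
  then show ?thesis by blast
qed

lemma hyperplane_image: "is_hyperplane H \<Longrightarrow> is_hyperplane (\<psi> ` H)"
  unfolding is_hyperplane_iff_tangent using tangent_image sphere_image by blast

text \<open>A hyperplane through \<open>\<psi> p\<close> and \<open>\<psi> q\<close> is pulled back
  by the inverse map to one through \<open>p\<close> and \<open>q\<close>, which therefore contains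
  \<open>x\<close>.\<close>

lemma line_image:
  assumes "x \<in> line_thru p q" shows "\<psi> x \<in> line_thru (\<psi> p) (\<psi> q)"
  unfolding line_thru_def
proof clarsimp
  fix H assume H: "is_hyperplane H" "\<psi> p \<in> H" "\<psi> q \<in> H"
  have "is_hyperplane (inv_into UNIV \<psi> ` H)"
    using sphere_bij.hyperplane_image[OF sphere_bij_inv H(1)] .
  moreover have mem: "y \<in> inv_into UNIV \<psi> ` H \<longleftrightarrow> \<psi> y \<in> H" for y
    using bij_image_Collect_eq[OF bij_imp_bij_inv[OF bij], of "\<lambda>z. z \<in> H"] bij by (simp add: inv_inv_eq)
  ultimately have "x \<in> inv_into UNIV \<psi> ` H" using assms H unfolding line_thru_def by blast
  then show "\<psi> x \<in> H" using mem by blast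
qed

lemma antipodal_image:
  assumes r: "0 < r" and im: "\<psi> ` sphere c r = sphere c' r'" and r': "0 < r'"
    and p: "p \<in> sphere c r" and q: "q \<in> sphere c r" and ne: "p \<noteq> q"
  shows "\<psi> p + \<psi> q = 2 *\<^sub>R c' \<longleftrightarrow> p + q = 2 *\<^sub>R c"
proof -
  have inj: "inj \<psi>" using bij by (simp add: bij_def)
  have "\<psi> p \<in> sphere c' r'" "\<psi> q \<in> sphere c' r'" "\<psi> p \<noteq> \<psi> q"
    using im p q ne inj by (auto simp: inj_eq)
  then have "\<psi> p + \<psi> q = 2 *\<^sub>R c' \<longleftrightarrow>
     tangent_at (\<psi> ` sphere c r) (\<psi> p) \<inter> tangent_at (\<psi> ` sphere c r) (\<psi> q) = {}"
    using antipodal_iff_tangents_disjoint[OF r', of "\<psi> p" c' "\<psi> q"] im by simp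
  also have "\<dots> \<longleftrightarrow> tangent_at (sphere c r) p \<inter> tangent_at (sphere c r) q = {}"
    using inj by (simp flip: tangent_image image_Int)
  also have "\<dots> \<longleftrightarrow> p + q = 2 *\<^sub>R c"
    using antipodal_iff_tangents_disjoint[OF r p q ne] .
  finally show ?thesis .
qed

text \<open>Each diameter of the image sphere comes from a diameter of the original one, whose line
  contains \<open>c\<close>. So \<open>\<psi> c\<close> lies on every line through
  \<open>c'\<close>, and the two orthogonal directions \<open>a\<close> and \<open>b\<close> leave
  only \<open>c'\<close> itself.\<close>

lemma sphere_centre_image:
  fixes a b :: 'a
  assumes ab: "a \<noteq> 0" "b \<noteq> 0" "a \<bullet> b = 0" and r: "0 < r"
  obtains r' where "0 < r'" "\<psi> ` sphere c r = sphere (\<psi> c) r'"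
proof -
  have "is_sphere (\<psi> ` sphere c r)" using sphere_image r by (auto simp: is_sphere_def)
  then obtain c' r' where r': "0 < r'" and im: "\<psi> ` sphere c r = sphere c' r'"
    by (auto simp: is_sphere_def)
  have on_diam: "\<exists>t. \<psi> c - c' = t *\<^sub>R v" if "v \<noteq> 0" for v
  proof -
    define u where "u = (r' / norm v) *\<^sub>R v"
    have nu: "norm u = r'" using that r' by (simp add: u_def)
    have "c' + u \<in> \<psi> ` sphere c r" "c' - u \<in> \<psi> ` sphere c r"
      unfolding im using nu by (simp_all add: dist_norm)
    then obtain p q where p: "p \<in> sphere c r" "\<psi> p = c' + u" and q: "q \<in> sphere c r" "\<psi> q = c' - u"
      by (metis imageE)
    have "\<psi> p - \<psi> q = 2 *\<^sub>R u" by (simp add: p q scaleR_2)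
    then have ne: "p \<noteq> q" using nu r' by auto
    have "\<psi> p + \<psi> q = 2 *\<^sub>R c'" by (simp add: p q scaleR_2)
    then have "p + q = 2 *\<^sub>R c" using antipodal_image[OF r im r' p(1) q(1) ne] by simp
    then have "q - p = 2 *\<^sub>R (c - p)" by (simp add: scaleR_2 algebra_simps)
    then have "c = p + (1/2) *\<^sub>R (q - p)" by simp
    then have "c \<in> line_thru p q" unfolding mem_line_thru by blast
    from line_image[OF this] obtain t where "\<psi> c = \<psi> p + t *\<^sub>R (\<psi> q - \<psi> p)"
      unfolding mem_line_thru by blast
    then have "\<psi> c - c' = u - t *\<^sub>R (2 *\<^sub>R u)" by (simp add: p q scaleR_2 algebra_simps)
    then have "\<psi> c - c' = (1 - 2 * t) *\<^sub>R u" by (simp add: algebra_simps)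
    then show ?thesis unfolding u_def by (metis scaleR_scaleR)
  qed
  obtain s t where st: "\<psi> c - c' = s *\<^sub>R a" "\<psi> c - c' = t *\<^sub>R b" using on_diam[OF ab(1)] on_diam[OF ab(2)] by blast
  have "(\<psi> c - c') \<bullet> (\<psi> c - c') = (s *\<^sub>R a) \<bullet> (t *\<^sub>R b)" using st by metis
  then have "\<psi> c = c'" using ab(3) by simp
  then show ?thesis using that r' im by blast
qed

text \<open>Two distinct points are antipodes on the sphere about their midpoint; antipodes and
  centres are both preserved.\<close>

lemma midpoint_image:
  fixes a b :: 'a
  assumes ab: "a \<noteq> 0" "b \<noteq> 0" "a \<bullet> b = 0"
  shows "\<psi> (midpoint x y) = midpoint (\<psi> x) (\<psi> y)"
proof (cases "x = y")
  case False
  define m where "m = midpoint x y"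
  define r where "r = dist x y / 2"
  have r: "0 < r" using False by (simp add: r_def)
  have xy: "x \<in> sphere m r" "y \<in> sphere m r"
    by (simp_all add: m_def r_def dist_midpoint)
  have sum: "x + y = 2 *\<^sub>R m" by (simp add: m_def midpoint_def)
  obtain r' where r': "0 < r'" "\<psi> ` sphere m r = sphere (\<psi> m) r'"
    using sphere_centre_image[OF ab r] by metis
  have "\<psi> x + \<psi> y = 2 *\<^sub>R \<psi> m"
    using antipodal_image[OF r r'(2,1) xy False] sum by simp
  then show ?thesis by (simp add: m_def midpoint_def)
qed simp


text \<open>Midpoints give additivity, hence homogeneity over the integers. Spheres about 0 go to
  spheres about 0, which yields the bound \<open>norm_le\<close> on segments, and an additive map
  with such a bound is real homogeneous.\<close>

theorem linear_similarity:
  fixes a b :: 'a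
  assumes ab: "a \<noteq> 0" "b \<noteq> 0" "a \<bullet> b = 0" and zero: "\<psi> 0 = 0"
  shows "linear \<psi>" and "\<exists>k. \<forall>x. norm (\<psi> x) = k * norm x"
proof -
  have half: "\<psi> ((1/2) *\<^sub>R x) = (1/2) *\<^sub>R \<psi> x" for x
    using midpoint_image[OF ab, of x 0] zero by (simp add: midpoint_def)
  have add: "\<psi> (x + y) = \<psi> x + \<psi> y" for x y
    using midpoint_image[OF ab, of x y] half[of "x + y"] by (simp add: midpoint_def)
  have neg: "\<psi> (- x) = - \<psi> x" for x
    using add[of x "- x"] zero by (simp add: add_eq_0_iff2)
  have nat: "\<psi> (real n *\<^sub>R x) = real n *\<^sub>R \<psi> x" for n x
    by (induction n) (simp_all add: zero add scaleR_left_distrib)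
  have int: "\<psi> (of_int n *\<^sub>R x) = of_int n *\<^sub>R \<psi> x" for n x
  proof (cases "0 \<le> n")
    case True
    then show ?thesis using nat[of "nat n" x] by simp
  next
    case False
    then show ?thesis using nat[of "nat (- n)" x] neg[of "of_int n *\<^sub>R x"] by simp
  qed
  have norm_cong: "norm (\<psi> x) = norm (\<psi> y)" if "norm x = norm y" for x y
  proof (cases "norm x = 0")
    case False
    then have "0 < norm x" by simp
    then obtain r' where im: "\<psi> ` sphere 0 (norm x) = sphere (\<psi> 0) r'"
      using sphere_centre_image[OF ab, of "norm x" 0] by metis
    have "x \<in> sphere 0 (norm x)" "y \<in> sphere 0 (norm x)" using that by simp_all
    then have "\<psi> x \<in> sphere 0 r'" "\<psi> y \<in> sphere 0 r'"
      using im zero by (metis imageI)+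
    then show ?thesis by simp
  qed (use that in auto)
  have norm_le: "norm (\<psi> (t *\<^sub>R x)) \<le> norm (\<psi> x)" if t: "0 \<le> t" "t \<le> 1" for t x
  proof -
    obtain w where w: "norm w = norm x" "w \<bullet> x = 0"
    proof -
      \<comment> \<open>A vector orthogonal to \<open>x\<close> in the span of \<open>a\<close> and
        \<open>b\<close>; it is nonzero because \<open>a\<close> and \<open>b\<close> are
        independent.\<close>
      define w0 where "w0 = (if x \<bullet> a = 0 then a else b - ((b \<bullet> x) / (a \<bullet> x)) *\<^sub>R a)"
      have w0: "w0 \<bullet> x = 0" by (auto simp: w0_def inner_commute inner_diff_right inner_diff_left)
      have "w0 \<noteq> 0"
      proof
        assume "w0 = 0"
        then have "x \<bullet> a \<noteq> 0" "b = ((b \<bullet> x) / (a \<bullet> x)) *\<^sub>R a" using ab by (auto simp: w0_def split: if_splits)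
        then have "b \<bullet> b = (((b \<bullet> x) / (a \<bullet> x)) *\<^sub>R a) \<bullet> b" by metis
        then show False using ab by simp
      qed
      then show ?thesis using that[of "(norm x / norm w0) *\<^sub>R w0"] w0 by simp
    qed
    define s where "s = sqrt (1 - t\<^sup>2)"
    have s: "t\<^sup>2 + s\<^sup>2 = 1" using t by (simp add: s_def abs_square_le_1)
    \<comment> \<open>The vector \<open>t *\<^sub>R x\<close> is the mean of two vectors of the same length as \<open>x\<close>.\<close>
    have len: "norm (t *\<^sub>R x + c *\<^sub>R w) = norm x" if "c\<^sup>2 = s\<^sup>2" for c
    proof -
      have "(t *\<^sub>R x + c *\<^sub>R w) \<bullet> (t *\<^sub>R x + c *\<^sub>R w) = t\<^sup>2 * (x \<bullet> x) + c\<^sup>2 * (w \<bullet> w)"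
        using w(2) by (simp add: inner_add_left inner_add_right inner_commute power2_eq_square)
      also have "w \<bullet> w = x \<bullet> x" using w(1) by (simp add: norm_eq)
      also have "t\<^sup>2 * (x \<bullet> x) + c\<^sup>2 * (x \<bullet> x) = x \<bullet> x"
        using s that by (metis distrib_right mult_1)
      finally show ?thesis by (simp only: norm_eq)
    qed
    have "2 *\<^sub>R \<psi> (t *\<^sub>R x) = \<psi> (t *\<^sub>R x + s *\<^sub>R w) + \<psi> (t *\<^sub>R x + (- s) *\<^sub>R w)"
      by (simp add: scaleR_2 flip: add)
    then have "2 * norm (\<psi> (t *\<^sub>R x)) = norm (\<psi> (t *\<^sub>R x + s *\<^sub>R w) + \<psi> (t *\<^sub>R x + (- s) *\<^sub>R w))"
      by (metis abs_numeral norm_scaleR)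
    also have "\<dots> \<le> norm (\<psi> x) + norm (\<psi> x)"
      using norm_cong[OF len[of s]] norm_cong[OF len[of "- s"]] norm_triangle_ineq
      by (metis power2_minus)
    finally show ?thesis by simp
  qed
  have scale: "\<psi> (t *\<^sub>R x) = t *\<^sub>R \<psi> x" for t x
  proof -
    \<comment> \<open>The defect of homogeneity. In \<open>n * t\<close> the integer part scales
      exactly, so \<open>n\<close> times \<open>D\<close> is governed by the fractional part and
      stays bounded in \<open>n\<close>; the Archimedean property then forces
      \<open>D = 0\<close>.\<close>
    define D where "D = \<psi> (t *\<^sub>R x) - t *\<^sub>R \<psi> x"
    have bound: "real n * norm D \<le> 2 * norm (\<psi> x)" for n
    proof -
      define e where "e = frac (real n * t)"
      have nt: "real n * t = of_int \<lfloor>real n * t\<rfloor> + e" by (simp add: e_def frac_def)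
      have e: "0 \<le> e" "e \<le> 1" by (simp_all add: e_def frac_ge_0 less_imp_le frac_lt_1)
      have "real n *\<^sub>R D = \<psi> ((real n * t) *\<^sub>R x) - (real n * t) *\<^sub>R \<psi> x"
        by (simp add: D_def scaleR_diff_right flip: nat)
      also have "\<dots> = \<psi> (e *\<^sub>R x) - e *\<^sub>R \<psi> x"
        by (subst (1 2) nt) (simp only: scaleR_left_distrib add int, simp)
      finally have "norm (real n *\<^sub>R D) \<le> norm (\<psi> (e *\<^sub>R x)) + norm (e *\<^sub>R \<psi> x)"
        using norm_triangle_ineq4 by metis
      also have "\<dots> \<le> norm (\<psi> x) + norm (\<psi> x)"
        using norm_le[OF e] e by (intro add_mono) (auto simp: mult_left_le_one_le)
      finally show ?thesis by simp
    qed
    have "norm D = 0"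
    proof (rule ccontr)
      assume "norm D \<noteq> 0"
      then obtain n where "2 * norm (\<psi> x) < real n * norm D"
        using reals_Archimedean3[of "norm D"] by auto
      then show False using bound[of n] by simp
    qed
    then show ?thesis by (simp add: D_def)
  qed
  show lin: "linear \<psi>" by (rule linearI) (simp_all add: add scale)
  define k where "k = norm (\<psi> a) / norm a"
  have "norm (\<psi> x) = k * norm x" for x
  proof -
    have "norm (norm a *\<^sub>R x) = norm (norm x *\<^sub>R a)" by simp
    then have "norm a * norm (\<psi> x) = norm x * norm (\<psi> a)"
      using norm_cong[of "norm a *\<^sub>R x" "norm x *\<^sub>R a"] by (simp add: scale)
    then show ?thesis using ab(1) by (simp add: k_def field_simps)
  qed
  then show "\<exists>k. \<forall>x. norm (\<psi> x) = k * norm x" by blast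
qed

end


section \<open>Quaternions as a normed division algebra\<close>

instantiation quat :: real_inner
begin

definition scaleR_quat :: "real \<Rightarrow> quat \<Rightarrow> quat" where
  "scaleR_quat r x = Quat (r * qRe x) (r * qI x) (r * qJ x) (r * qK x)"

definition inner_quat :: "quat \<Rightarrow> quat \<Rightarrow> real" where
  "inner_quat x y = qRe x * qRe y + qI x * qI y + qJ x * qJ y + qK x * qK y"

definition norm_quat :: "quat \<Rightarrow> real" where
  "norm_quat x = sqrt (inner x x)"

definition sgn_quat :: "quat \<Rightarrow> quat" where
  "sgn_quat x = inverse (norm x) *\<^sub>R x"

definition dist_quat :: "quat \<Rightarrow> quat \<Rightarrow> real" where
  "dist_quat x y = norm (x - y)"

definition uniformity_quat :: "(quat \<times> quat) filter" where
  "uniformity_quat = (INF e\<in>{0 <..}. principal {(x, y). dist x y < e})"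

definition open_quat :: "quat set \<Rightarrow> bool" where
  "open_quat U \<longleftrightarrow> (\<forall>x\<in>U. eventually (\<lambda>(x', y). x' = x \<longrightarrow> y \<in> U) uniformity)"

instance
proof
  fix x :: quat
  show "inner x x = 0 \<longleftrightarrow> x = 0"
    using qnorm_eq_0_iff[of x] by (simp add: inner_quat_def qnorm_sum_squares power2_eq_square)
qed (simp_all add: scaleR_quat_def inner_quat_def norm_quat_def sgn_quat_def dist_quat_def
    uniformity_quat_def open_quat_def quat_eq_iff quat_arith_defs algebra_simps)

end

lemma qnorm_eq_norm: "qnorm x = (norm x)\<^sup>2"
  by (simp add: norm_quat_def qnorm_sum_squares inner_quat_def power2_eq_square)

text \<open>Multiplicativity of the norm is Euler's four-square identity.\<close>

instance quat :: real_normed_div_algebra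
proof
  fix x y :: quat
  show "norm (x * y) = norm x * norm y"
    unfolding norm_quat_def real_sqrt_mult[symmetric]
    by (simp add: inner_quat_def quat_arith_defs algebra_simps)
qed (simp_all add: scaleR_quat_def quat_eq_iff quat_arith_defs algebra_simps)

lemma quat_sel_simps [simp]:
  "qRe (x + y) = qRe x + qRe y" "qRe (x - y) = qRe x - qRe y" "qRe (- x) = - qRe x"
  "qRe 0 = 0" "qRe 1 = 1" "qRe (r *\<^sub>R x) = r * qRe x" "qRe (qcnj x) = qRe x"
  by (simp_all add: quat_arith_defs scaleR_quat_def qcnj_def)

lemma qcnj_simps [simp]:
  "qcnj (x + y) = qcnj x + qcnj y" "qcnj (x - y) = qcnj x - qcnj y" "qcnj (- x) = - qcnj x"
  "qcnj 0 = 0" "qcnj 1 = 1" "qcnj (r *\<^sub>R x) = r *\<^sub>R qcnj x" "qcnj (qcnj x) = x"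
  "qcnj (x * y) = qcnj y * qcnj x"
  by (simp_all add: quat_arith_defs scaleR_quat_def qcnj_def)

lemma inner_quat_qcnj: "inner x y = qRe (qcnj x * y)" for x y :: quat
  by (simp add: inner_quat_def qcnj_def quat_arith_defs)

lemma qRe_mult_commute: "qRe (x * y) = qRe (y * x)"
  by (simp add: quat_arith_defs)

lemma qRe_eq_inner_one: "qRe x = inner 1 x"
  by (simp add: inner_quat_def quat_arith_defs)

text \<open>Shows that a linear map which fixes 1 and preserves real parts commutes with
  conjugation.\<close>

lemma qcnj_eq: "qcnj x = (2 * qRe x) *\<^sub>R 1 - x"
  by (simp add: quat_eq_iff quat_arith_defs scaleR_quat_def qcnj_def)

lemma norm_qcnj [simp]: "norm (qcnj x) = norm x"
  by (simp add: norm_quat_def inner_quat_def qcnj_def)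

lemma qcnj_mult_self: "qcnj x * x = (norm x)\<^sup>2 *\<^sub>R 1"
  by (simp add: quat_eq_iff quat_arith_defs scaleR_quat_def qcnj_def norm_quat_def inner_quat_def)

lemma qtr_eq: "qtr x = 2 * qRe x"
  by (simp add: qtr_def)

section \<open>The quaternion units and automorphisms of the quaternions\<close>

definition quat_i :: quat where "quat_i = Quat 0 1 0 0"
definition quat_j :: quat where "quat_j = Quat 0 0 1 0"
definition quat_k :: quat where "quat_k = Quat 0 0 0 1"

lemmas quat_units_defs = quat_i_def quat_j_def quat_k_def

lemma quat_expand: "x = qRe x *\<^sub>R 1 + qI x *\<^sub>R quat_i + qJ x *\<^sub>R quat_j + qK x *\<^sub>R quat_k"
  by (simp add: quat_eq_iff quat_units_defs scaleR_quat_def one_quat_def plus_quat_def)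

lemma quat_units_mult:
  "quat_i * quat_i = - 1" "quat_j * quat_j = - 1" "quat_k * quat_k = - 1"
  "quat_i * quat_j = quat_k" "quat_j * quat_k = quat_i" "quat_k * quat_i = quat_j"
  "quat_j * quat_i = - quat_k" "quat_k * quat_j = - quat_i" "quat_i * quat_k = - quat_j"
  by (simp_all add: quat_units_defs quat_arith_defs)

text \<open>Averaging \<open>x \<mapsto> \<phi> g * x * inverse g\<close> over the quaternion group yields an intertwiner of
  \<open>\<phi>\<close> and the identity.\<close>

lemma quat_automorphism_inner:
  fixes \<phi> :: "quat \<Rightarrow> quat"
  assumes lin: "linear \<phi>" and one: "\<phi> 1 = 1" and mult: "\<And>x y. \<phi> (x * y) = \<phi> x * \<phi> y"
  obtains p where "p \<noteq> 0" "\<And>x. \<phi> x * p = p * x"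
proof -
  \<comment> \<open>The elements \<open>g\<close> and \<open>- g\<close> contribute equally and the
    inverse of an imaginary unit is its negative, so this is the group average up to a real
    factor.\<close>
  define P where "P x = x - \<phi> quat_i * x * quat_i - \<phi> quat_j * x * quat_j - \<phi> quat_k * x * quat_k" for x
  let ?I = "\<phi> quat_i" and ?J = "\<phi> quat_j" and ?K = "\<phi> quat_k"
  have neg: "\<phi> (- x) = - \<phi> x" for x using lin by (rule linear_neg)
  \<comment> \<open>The multiplication table of the image units carries a trailing factor
    \<open>y\<close> because products are kept associated to the right.\<close>
  have M: "?I * (?I * y) = - y" "?J * (?J * y) = - y" "?K * (?K * y) = - y"
    "?I * (?J * y) = ?K * y" "?J * (?K * y) = ?I * y" "?K * (?I * y) = ?J * y"
    "?J * (?I * y) = - (?K * y)" "?K * (?J * y) = - (?I * y)" "?I * (?K * y) = - (?J * y)" for y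
    by (simp_all add: neg one quat_units_mult flip: mult.assoc mult)
  have int: "\<phi> y * P x = P x * y" if y: "y = quat_i \<or> y = quat_j \<or> y = quat_k" for x y
    using y by (auto simp: P_def algebra_simps M mult.assoc quat_units_mult)
  have comm: "\<phi> y * P x = P x * y" for x y
  proof -
    have "\<phi> y = qRe y *\<^sub>R 1 + qI y *\<^sub>R ?I + qJ y *\<^sub>R ?J + qK y *\<^sub>R ?K"
      by (subst quat_expand[of y]) (simp add: linear_add[OF lin] linear_scale[OF lin] one)
    moreover have "P x * y = P x * (qRe y *\<^sub>R 1 + qI y *\<^sub>R quat_i + qJ y *\<^sub>R quat_j + qK y *\<^sub>R quat_k)"
      using quat_expand[of y] by simp
    ultimately show ?thesis by (simp add: distrib_left distrib_right int)
  qed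
  \<comment> \<open>In this combination the terms with image units cancel, so \<open>P\<close>
    cannot vanish identically.\<close>
  have four: "P 1 - P quat_i * quat_i - P quat_j * quat_j - P quat_k * quat_k = 4"
    by (simp add: P_def algebra_simps M mult.assoc quat_units_mult)
  have "\<exists>x. P x \<noteq> 0"
  proof (rule ccontr)
    assume "\<not> (\<exists>x. P x \<noteq> 0)"
    then have "P x = 0" for x by blast
    then show False using four by simp
  qed
  then show thesis using that comm by blast
qed


section \<open>Heisenberg coordinates and shadows of chains\<close>

text \<open>\<open>rscale\<close> is confined to the index types \<open>'m coord\<close>; this
  version also scales the middle block \<open>quat ^ 'm\<close>.\<close>

definition rmul :: "quat ^ 'n \<Rightarrow> quat \<Rightarrow> quat ^ 'n" (infixl "\<star>" 75) where
  "v \<star> a = (\<chi> i. v $ i * a)"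

definition herm :: "quat ^ 'n \<Rightarrow> quat ^ 'n \<Rightarrow> quat" where
  "herm v w = (\<Sum>i\<in>UNIV. qcnj (v $ i) * w $ i)"

lemma rmul_nth [simp]: "(v \<star> a) $ i = v $ i * a"
  by (simp add: rmul_def)

lemma rmul_simps [simp]:
  "v \<star> 1 = v" "v \<star> 0 = 0" "0 \<star> a = 0" "v \<star> (- a) = - (v \<star> a)" "(- v) \<star> a = - (v \<star> a)"
  "v \<star> (r *\<^sub>R a) = r *\<^sub>R (v \<star> a)" "(r *\<^sub>R v) \<star> a = r *\<^sub>R (v \<star> a)"
  by (simp_all add: vec_eq_iff)

lemma rmul_add_left: "(v + w) \<star> a = v \<star> a + w \<star> a"
  and rmul_add_right: "v \<star> (a + b) = v \<star> a + v \<star> b"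
  and rmul_diff_left: "(v - w) \<star> a = v \<star> a - w \<star> a"
  and rmul_diff_right: "v \<star> (a - b) = v \<star> a - v \<star> b"
  and rmul_assoc: "v \<star> a \<star> b = v \<star> (a * b)"
  by (simp_all add: vec_eq_iff algebra_simps)

lemmas rmul_distribs = rmul_add_left rmul_add_right rmul_diff_left rmul_diff_right

lemma norm_rmul: "norm (v \<star> a) = norm v * norm a" for v :: "quat ^ 'n::finite"
  by (simp add: norm_vec_def norm_mult L2_set_left_distrib flip: L2_set_right_distrib)

lemma rmul_eq_0_iff: "v \<star> a = 0 \<longleftrightarrow> v = 0 \<or> a = 0" for v :: "quat ^ 'n::finite"
  using norm_rmul[of v a] by (metis mult_eq_0_iff norm_eq_zero)

lemma rmul_cancel_left: "v \<noteq> 0 \<Longrightarrow> v \<star> a = v \<star> b \<longleftrightarrow> a = b" for v :: "quat ^ 'n::finite"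
  using rmul_eq_0_iff[of v "a - b"] by (simp add: rmul_diff_right)

lemma herm_simps [simp]:
  "herm v (w \<star> a) = herm v w * a" "herm v 0 = 0" "herm 0 w = 0"
  "herm v (w + w') = herm v w + herm v w'" "herm v (- w) = - herm v w"
  by (simp_all add: herm_def sum_distrib_right mult.assoc distrib_left sum.distrib sum_negf)

lemma inner_eq_qRe_herm: "inner v w = qRe (herm v w)" for v :: "quat ^ 'n::finite"
proof -
  have "qRe (sum g A) = (\<Sum>i\<in>A. qRe (g i))" if "finite A" for g and A :: "'n set"
    using that by (induction A) auto
  then show ?thesis by (simp add: herm_def inner_vec_def inner_quat_qcnj)
qed

lemma exists_nonzero_vec: "\<exists>v :: quat ^ 'n. v \<noteq> 0"
  by (rule exI[of _ "\<chi> i. 1"]) (simp add: vec_eq_iff)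

text \<open>The diameter of the first sphere in the direction \<open>a - b\<close> has both ends at
  the same distance from \<open>b\<close>, which makes \<open>a - b\<close> orthogonal to
  itself.\<close>

lemma sphere_centre_unique:
  fixes a b :: "'a::real_inner"
  assumes eq: "sphere a r = sphere b s" and r: "0 < r"
  shows "a = b"
proof (rule ccontr)
  assume ne: "a \<noteq> b"
  define d where "d = a - b"
  define u where "u = (r / norm d) *\<^sub>R d"
  have "norm u = r" using ne r by (simp add: u_def d_def)
  then have "a + u \<in> sphere a r" "a - u \<in> sphere a r" by (simp_all add: dist_norm)
  then have "norm (d + u) = s" "norm (d - u) = s"
    unfolding eq by (simp_all add: dist_norm d_def norm_minus_commute algebra_simps)
  then have "(d + u) \<bullet> (d + u) = (d - u) \<bullet> (d - u)" by (metis norm_eq)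
  then have "d \<bullet> u = 0" by (simp add: inner_add_left inner_add_right inner_diff_left inner_diff_right inner_commute)
  then show False using ne r by (simp add: u_def d_def)
qed

lemma affine_image_sphere:
  fixes a :: quat
  assumes "a \<noteq> 0"
  shows "(\<lambda>b. s + a * b) ` sphere c r = sphere (s + a * c) (norm a * r)"
proof -
  have eq: "dist (s + a * c) (s + a * b) = norm a * dist c b" for b
    by (simp add: dist_norm norm_mult flip: right_diff_distrib)
  have "y \<in> (\<lambda>b. s + a * b) ` sphere c r" if "y \<in> sphere (s + a * c) (norm a * r)" for y
  proof
    show y: "y = s + a * (inverse a * (y - s))" using assms by (simp flip: mult.assoc)
    show "inverse a * (y - s) \<in> sphere c r" using that eq[of "inverse a * (y - s)"] y assms by auto
  qed
  then show ?thesis using eq by auto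
qed

text \<open>The pair \<open>(\<zeta>, u)\<close> stands for the boundary point with homogeneous
  coordinates 1, \<open>\<zeta>\<close>, \<open>u\<close>; the equation says that
  \<open>qform\<close> vanishes there.\<close>

definition heis :: "((quat ^ 'm::finite) \<times> quat) set" where
  "heis = {x. 2 * qRe (snd x) = (norm (fst x))\<^sup>2}"

text \<open>Points with first coordinate 1 on the projective line through two such points are the
  combinations with right coefficients \<open>1 - b\<close> and \<open>b\<close>.\<close>

definition cochain :: "(quat ^ 'm::finite) \<times> quat \<Rightarrow> (quat ^ 'm) \<times> quat \<Rightarrow> (quat ^ 'm) \<times> quat \<Rightarrow> bool" where
  "cochain x y z \<longleftrightarrow> (\<exists>b. fst z = fst x + (fst y - fst x) \<star> b \<and> snd z = snd x + (snd y - snd x) * b)"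

text \<open>The projection to the \<open>\<zeta>\<close>-space of the chain through \<open>x\<close>
  and \<open>y\<close>, for points with different first components.\<close>

definition chain_shadow :: "(quat ^ 'm::finite) \<times> quat \<Rightarrow> (quat ^ 'm) \<times> quat \<Rightarrow> (quat ^ 'm) set" where
  "chain_shadow x y = {fst z | z. z \<in> heis \<and> cochain x y z}"

text \<open>The centre is measured in the parameter \<open>b\<close> of the line
  \<open>\<zeta> + \<delta> \<star> b\<close>. The intended \<open>e\<close> is
  \<open>w - u - herm \<zeta> \<delta>\<close>, and the radius is the norm of the centre because the
  sphere passes through the parameter 0.\<close>

definition shadow_centre :: "quat ^ 'm::finite \<Rightarrow> quat \<Rightarrow> quat" where
  "shadow_centre \<delta> e = (1 / (norm \<delta>)\<^sup>2) *\<^sub>R qcnj e"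

lemma norm_add_rmul_sq:
  "(norm (\<zeta> + \<delta> \<star> b))\<^sup>2 = (norm \<zeta>)\<^sup>2 + 2 * qRe (herm \<zeta> \<delta> * b) + (norm \<delta>)\<^sup>2 * (norm b)\<^sup>2"
proof -
  have "(norm (\<zeta> + w))\<^sup>2 = (norm \<zeta>)\<^sup>2 + 2 * (\<zeta> \<bullet> w) + (norm w)\<^sup>2" for w
    by (simp add: power2_norm_eq_inner inner_add_left inner_add_right inner_commute)
  from this[of "\<delta> \<star> b"] show ?thesis
    by (simp add: inner_eq_qRe_herm norm_rmul power_mult_distrib)
qed

text \<open>For nonzero \<open>\<delta>\<close> this says that the shadow centre has real part 1/2,
  or equivalently that the sphere also passes through the parameter 1 of the second point.\<close>

lemma heis_slope_real:
  assumes "(\<zeta>, u) \<in> heis" "(\<zeta> + \<delta>, w) \<in> heis"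
  shows "2 * qRe (w - u - herm \<zeta> \<delta>) = (norm \<delta>)\<^sup>2"
  using assms norm_add_rmul_sq[of \<zeta> \<delta> 1] by (simp add: heis_def)

text \<open>Subtracting the equation of the first point leaves
  \<open>(norm \<delta>)\<^sup>2 * (norm b)\<^sup>2 = 2 * qRe (e * b)\<close>. With \<open>c\<close>
  the shadow centre this is \<open>(norm b)\<^sup>2 = 2 * (c \<bullet> b)\<close>, a sphere through
  0 about \<open>c\<close>.\<close>

lemma heis_combination_iff:
  assumes x: "(\<zeta>, u) \<in> heis" and d: "\<delta> \<noteq> 0"
  shows "(\<zeta> + \<delta> \<star> b, u + (w - u) * b) \<in> heis \<longleftrightarrow>
    b \<in> sphere (shadow_centre \<delta> (w - u - herm \<zeta> \<delta>)) (norm (shadow_centre \<delta> (w - u - herm \<zeta> \<delta>)))"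
proof -
  define e where "e = w - u - herm \<zeta> \<delta>"
  define c where "c = shadow_centre \<delta> e"
  have cb: "(norm \<delta>)\<^sup>2 * (c \<bullet> b) = qRe (e * b)"
    using d by (simp add: c_def shadow_centre_def inner_quat_qcnj)
  have "b \<in> sphere c (norm c) \<longleftrightarrow> (norm b)\<^sup>2 = 2 * (c \<bullet> b)"
    unfolding mem_sphere_inner[OF norm_ge_zero]
    by (simp add: inner_diff_left inner_diff_right inner_commute power2_norm_eq_inner)
  also have "\<dots> \<longleftrightarrow> (norm \<delta>)\<^sup>2 * (norm b)\<^sup>2 = (norm \<delta>)\<^sup>2 * (2 * (c \<bullet> b))"
    using d by simp
  also have "\<dots> \<longleftrightarrow> (norm \<delta>)\<^sup>2 * (norm b)\<^sup>2 = 2 * qRe (e * b)"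
    by (simp add: cb[symmetric])
  finally have "b \<in> sphere c (norm c) \<longleftrightarrow> (norm \<delta>)\<^sup>2 * (norm b)\<^sup>2 = 2 * qRe (e * b)" .
  moreover have "qRe (e * b) = qRe ((w - u) * b) - qRe (herm \<zeta> \<delta> * b)"
    by (simp add: e_def left_diff_distrib)
  ultimately show ?thesis
    using x norm_add_rmul_sq[of \<zeta> \<delta> b] by (auto simp: heis_def e_def c_def)
qed

lemma chain_shadow_eq:
  assumes x: "(\<zeta>, u) \<in> heis" and d: "\<delta> \<noteq> 0" and c: "c = shadow_centre \<delta> (w - u - herm \<zeta> \<delta>)"
  shows "chain_shadow (\<zeta>, u) (\<zeta> + \<delta>, w) = (\<lambda>b. \<zeta> + \<delta> \<star> b) ` sphere c (norm c)"
  using heis_combination_iff[OF x d, of _ w, folded c]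
  by (auto simp: chain_shadow_def cochain_def set_eq_iff image_iff) blast+

lemma shadow_centre_nonzero:
  assumes "(\<zeta>, u) \<in> heis" "(\<zeta> + \<delta>, w) \<in> heis" "\<delta> \<noteq> 0"
  shows "shadow_centre \<delta> (w - u - herm \<zeta> \<delta>) \<noteq> 0"
proof
  assume "shadow_centre \<delta> (w - u - herm \<zeta> \<delta>) = 0"
  then have "qRe (shadow_centre \<delta> (w - u - herm \<zeta> \<delta>)) = 0" by simp
  then have "qRe (w - u - herm \<zeta> \<delta>) = 0"
    using assms(3) by (simp add: shadow_centre_def)
  then show False using heis_slope_real[OF assms(1,2)] assms(3) by simp
qed

lemma heis_lift: "(\<zeta>, ((norm \<zeta>)\<^sup>2 / 2) *\<^sub>R 1) \<in> heis"
  by (simp add: heis_def)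

text \<open>The formula for the shadow centre can be solved for \<open>w\<close>, and real part 1/2
  is what puts the solution in \<open>heis\<close>. So every such centre occurs over the given first
  point.\<close>

lemma chain_with_centre:
  assumes x: "(\<zeta>, u) \<in> heis" and d: "\<delta> \<noteq> 0" and c: "qRe c = 1 / 2"
  obtains w where "(\<zeta> + \<delta>, w) \<in> heis"
    "chain_shadow (\<zeta>, u) (\<zeta> + \<delta>, w) = (\<lambda>b. \<zeta> + \<delta> \<star> b) ` sphere c (norm c)"
proof -
  define w where "w = u + herm \<zeta> \<delta> + (norm \<delta>)\<^sup>2 *\<^sub>R qcnj c"
  have c': "c = shadow_centre \<delta> (w - u - herm \<zeta> \<delta>)"
    using d by (simp add: shadow_centre_def w_def)
  have "(\<zeta> + \<delta>, w) \<in> heis"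
    using x norm_add_rmul_sq[of \<zeta> \<delta> 1] c by (simp add: heis_def w_def)
  then show thesis using that chain_shadow_eq[OF x d c'] by blast
qed

text \<open>The two base points are the ends of the diameter in the real direction. Relative to them
  the centre has parameter 1/2, which \<open>chain_with_centre\<close> realizes.\<close>

lemma chain_over_sphere:
  fixes \<zeta> :: "quat ^ 'm::finite"
  assumes d: "\<delta> \<noteq> 0" and r: "0 < r"
  obtains x y where "x \<in> heis" "y \<in> heis" "fst x \<noteq> fst y"
    "fst x = \<zeta> + \<delta> \<star> (c - r *\<^sub>R 1)" "fst y = \<zeta> + \<delta> \<star> (c + r *\<^sub>R 1)"
    "chain_shadow x y = (\<lambda>b. \<zeta> + \<delta> \<star> b) ` sphere c r"
proof -
  define \<zeta>' where "\<zeta>' = \<zeta> + \<delta> \<star> (c - r *\<^sub>R 1)"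
  define \<delta>' where "\<delta>' = \<delta> \<star> ((2 * r) *\<^sub>R 1)"
  have d': "\<delta>' \<noteq> 0" using d r by (simp add: \<delta>'_def)
  have half: "qRe ((1/2) *\<^sub>R 1) = 1 / 2" by simp
  obtain w where w: "(\<zeta>' + \<delta>', w) \<in> heis"
    "chain_shadow (\<zeta>', ((norm \<zeta>')\<^sup>2 / 2) *\<^sub>R 1) (\<zeta>' + \<delta>', w)
      = (\<lambda>b. \<zeta>' + \<delta>' \<star> b) ` sphere ((1/2) *\<^sub>R 1) (norm ((1/2) *\<^sub>R (1::quat)))"
    using chain_with_centre[OF heis_lift d' half] by blast
  note w(2)
  also have "(\<lambda>b. \<zeta>' + \<delta>' \<star> b) ` sphere ((1/2) *\<^sub>R 1) (norm ((1/2) *\<^sub>R (1::quat)))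
      = (\<lambda>b. \<zeta> + \<delta> \<star> b) ` ((\<lambda>b. (c - r *\<^sub>R 1) + ((2 * r) *\<^sub>R 1) * b) `
        sphere ((1/2) *\<^sub>R 1) (norm ((1/2) *\<^sub>R (1::quat))))"
    by (simp add: image_image \<zeta>'_def \<delta>'_def rmul_add_right add.assoc)
  also have "(\<lambda>b. (c - r *\<^sub>R 1) + ((2 * r) *\<^sub>R 1) * b) ` sphere ((1/2) *\<^sub>R 1) (norm ((1/2) *\<^sub>R (1::quat))) = sphere c r"
    using r by (subst affine_image_sphere) auto
  finally have "chain_shadow (\<zeta>', ((norm \<zeta>')\<^sup>2 / 2) *\<^sub>R 1) (\<zeta>' + \<delta>', w) = (\<lambda>b. \<zeta> + \<delta> \<star> b) ` sphere c r" .
  moreover have "\<zeta>' + \<delta>' = \<zeta> + \<delta> \<star> (c + r *\<^sub>R 1)"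
  proof -
    have "(2 * r) *\<^sub>R (1::quat) = r *\<^sub>R 1 + r *\<^sub>R 1" by (simp flip: scaleR_left_distrib)
    then have "c + r *\<^sub>R 1 = (c - r *\<^sub>R 1) + (2 * r) *\<^sub>R 1" by simp
    then show ?thesis by (simp only: \<zeta>'_def \<delta>'_def rmul_add_right add.assoc)
  qed
  ultimately show thesis
    using that[OF heis_lift[of \<zeta>'] w(1)] d' by (simp add: \<zeta>'_def)
qed

text \<open>The substitution of \<open>s + (t - s) * b\<close> for \<open>b\<close> turns the
  parameter based at \<open>x\<close> and \<open>y\<close> into that of the given line, and it maps
  spheres to spheres.\<close>

lemma chain_shadow_in_line:
  assumes x: "x \<in> heis" and y: "y \<in> heis" and ne: "fst x \<noteq> fst y"
    and xs: "fst x = \<zeta> + \<delta> \<star> s" and yt: "fst y = \<zeta> + \<delta> \<star> t"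
  obtains S where "is_sphere S" "chain_shadow x y = (\<lambda>b. \<zeta> + \<delta> \<star> b) ` S"
proof -
  obtain \<xi> u where xu: "x = (\<xi>, u)" by (cases x)
  define \<epsilon> where "\<epsilon> = fst y - fst x"
  obtain w where yw: "y = (\<xi> + \<epsilon>, w)" using xu by (cases y) (simp add: \<epsilon>_def)
  have e: "\<epsilon> \<noteq> 0" using ne by (simp add: \<epsilon>_def)
  have eds: "\<epsilon> = \<delta> \<star> (t - s)" by (simp add: \<epsilon>_def xs yt rmul_distribs)
  then have ts: "t - s \<noteq> 0" using e by auto
  define c where "c = shadow_centre \<epsilon> (w - u - herm \<xi> \<epsilon>)"
  have c: "c \<noteq> 0" using shadow_centre_nonzero x y e xu yw by (simp add: c_def)
  have "chain_shadow x y = (\<lambda>b. \<xi> + \<epsilon> \<star> b) ` sphere c (norm c)"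
    using chain_shadow_eq[OF _ e c_def] x xu yw by simp
  also have "\<dots> = (\<lambda>b. \<zeta> + \<delta> \<star> b) ` ((\<lambda>b. s + (t - s) * b) ` sphere c (norm c))"
    using xs xu eds by (simp add: image_image rmul_add_right rmul_assoc add.assoc)
  also have "(\<lambda>b. s + (t - s) * b) ` sphere c (norm c) = sphere (s + (t - s) * c) (norm (t - s) * norm c)"
    using ts by (rule affine_image_sphere)
  finally have "chain_shadow x y = (\<lambda>b. \<zeta> + \<delta> \<star> b) ` sphere (s + (t - s) * c) (norm (t - s) * norm c)" .
  moreover have "is_sphere (sphere (s + (t - s) * c) (norm (t - s) * norm c))"
    unfolding is_sphere_def using ts c by (intro exI conjI) auto
  ultimately show thesis using that by blast
qed


section \<open>Maps of the Heisenberg space preserving chains\<close>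

text \<open>The chain-preserving map in coordinates, with infinity fixed: \<open>vertical\<close>
  expresses the chains through infinity, \<open>cochain\<close> all others. Equivalences are assumed
  so that the inverse qualifies too.\<close>

locale heis_map =
  fixes h :: "(quat ^ 'm::finite) \<times> quat \<Rightarrow> (quat ^ 'm) \<times> quat"
  assumes h_bij: "bij_betw h heis heis"
    and vertical: "\<lbrakk>x \<in> heis; y \<in> heis\<rbrakk> \<Longrightarrow> fst (h x) = fst (h y) \<longleftrightarrow> fst x = fst y"
    and cochain: "\<lbrakk>x \<in> heis; y \<in> heis; z \<in> heis; fst x \<noteq> fst y\<rbrakk> \<Longrightarrow>
      cochain (h x) (h y) (h z) \<longleftrightarrow> cochain x y z"
begin

text \<open>The induced map on the \<open>\<zeta>\<close>-space, read off at the point over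
  \<open>\<zeta>\<close> with real second component; by \<open>vertical\<close> any other point over
  \<open>\<zeta>\<close> gives the same value.\<close>

definition base :: "quat ^ 'm \<Rightarrow> quat ^ 'm" where
  "base \<zeta> = fst (h (\<zeta>, ((norm \<zeta>)\<^sup>2 / 2) *\<^sub>R 1))"

lemma h_heis: "x \<in> heis \<Longrightarrow> h x \<in> heis"
  using h_bij by (rule bij_betwE[rule_format])

lemma fst_h: "x \<in> heis \<Longrightarrow> fst (h x) = base (fst x)"
  unfolding base_def using vertical[OF _ heis_lift] by simp

lemma inj_base: "inj base"
  by (rule injI) (use vertical[OF heis_lift heis_lift] in \<open>simp add: base_def\<close>)

lemma inverse_map: "heis_map (inv_into heis h)"
proof
  have surj: "h ` heis = heis" using h_bij by (simp add: bij_betw_def)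
  have into: "inv_into heis h x \<in> heis" and h_inv: "h (inv_into heis h x) = x" if "x \<in> heis" for x
    using that surj by (auto intro: inv_into_into f_inv_into_f)
  show "bij_betw (inv_into heis h) heis heis" using h_bij by (rule bij_betw_inv_into)
  show v: "fst (inv_into heis h x) = fst (inv_into heis h y) \<longleftrightarrow> fst x = fst y"
    if "x \<in> heis" "y \<in> heis" for x y
    using vertical[OF into into, of x y] that by (simp add: h_inv)
  show "cochain (inv_into heis h x) (inv_into heis h y) (inv_into heis h z) \<longleftrightarrow> cochain x y z"
    if "x \<in> heis" "y \<in> heis" "z \<in> heis" "fst x \<noteq> fst y" for x y z
    using cochain[OF into into into, of x y z] that v[of x y] by (simp add: h_inv)
qed

lemma inverse_base: "heis_map.base (inv_into heis h) (base \<zeta>) = \<zeta>"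
proof -
  let ?x = "(\<zeta>, ((norm \<zeta>)\<^sup>2 / 2) *\<^sub>R 1) :: (quat ^ 'm) \<times> quat"
  have "inv_into heis h (h ?x) = ?x"
    using h_bij heis_lift[of \<zeta>] by (simp add: bij_betw_inv_into_left)
  moreover have "fst (inv_into heis h (h ?x)) = heis_map.base (inv_into heis h) (fst (h ?x))"
    by (rule heis_map.fst_h[OF inverse_map h_heis[OF heis_lift]])
  ultimately show ?thesis using fst_h[OF heis_lift[of \<zeta>]] by simp
qed

lemma base_inverse: "base (heis_map.base (inv_into heis h) \<eta>) = \<eta>"
proof -
  let ?y = "(\<eta>, ((norm \<eta>)\<^sup>2 / 2) *\<^sub>R 1) :: (quat ^ 'm) \<times> quat"
  obtain x where x: "x \<in> heis" "h x = ?y" using h_bij heis_lift[of \<eta>] by (metis bij_betw_def imageE)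
  then have "base (fst x) = \<eta>" using fst_h by fastforce
  then show ?thesis using inverse_base by metis
qed

lemma bij_base: "bij base"
  using inj_base base_inverse by (metis bijI surjI)

lemma base_shadow:
  assumes "x \<in> heis" "y \<in> heis" "fst x \<noteq> fst y"
  shows "base ` chain_shadow x y = chain_shadow (h x) (h y)"
proof
  show "base ` chain_shadow x y \<subseteq> chain_shadow (h x) (h y)"
  proof clarify
    fix \<zeta> assume "\<zeta> \<in> chain_shadow x y"
    then obtain z where z: "\<zeta> = fst z" "z \<in> heis" "cochain x y z" by (auto simp: chain_shadow_def)
    then have "cochain (h x) (h y) (h z)" using cochain[of x y z] assms by simp
    then show "base \<zeta> \<in> chain_shadow (h x) (h y)"
      using z(1) h_heis[OF z(2)] unfolding fst_h[OF z(2), symmetric] chain_shadow_def z(1) by blast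
  qed
  show "chain_shadow (h x) (h y) \<subseteq> base ` chain_shadow x y"
  proof
    fix \<eta> assume "\<eta> \<in> chain_shadow (h x) (h y)"
    then obtain z' where z': "\<eta> = fst z'" "z' \<in> heis" "cochain (h x) (h y) z'" by (auto simp: chain_shadow_def)
    obtain z where z: "z \<in> heis" "z' = h z" using h_bij z'(2) by (metis bij_betw_def imageE)
    then have "cochain x y z" using cochain[of x y z] assms z'(3) by simp
    then have "fst z \<in> chain_shadow x y" unfolding chain_shadow_def using z(1) by blast
    then show "\<eta> \<in> base ` chain_shadow x y" using z z'(1) fst_h by auto
  qed
qed

text \<open>The parameters 0, 1 and a nonreal \<open>b\<close> are not collinear, so some sphere
  that is the shadow of a chain passes through all three. The image chain then keeps the three image
  points on one quaternionic line.\<close>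

lemma base_maps_line_nonreal:
  assumes d: "\<delta> \<noteq> 0" and b: "b \<noteq> qRe b *\<^sub>R 1"
  shows "\<exists>b'. base (\<zeta> + \<delta> \<star> b) = base \<zeta> + (base (\<zeta> + \<delta>) - base \<zeta>) \<star> b'"
proof -
  define v where "v = b - qRe b *\<^sub>R 1"
  have v: "v \<noteq> 0" "qRe v = 0" using b by (simp_all add: v_def)
  \<comment> \<open>The point equidistant from 0, 1 and \<open>b\<close> in the plane spanned by 1
    and \<open>v\<close>.\<close>
  define c where "c = (1/2) *\<^sub>R 1 + (((norm b)\<^sup>2 - qRe b) / (2 * (norm v)\<^sup>2)) *\<^sub>R v"
  have c: "qRe c = 1 / 2" by (simp add: c_def v)
  have "v \<bullet> b = (norm v)\<^sup>2"
  proof -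
    have "b = v + qRe b *\<^sub>R 1" by (simp add: v_def)
    then have "v \<bullet> b = v \<bullet> (v + qRe b *\<^sub>R 1)" by simp
    then show ?thesis using v(2) by (simp add: inner_add_right power2_norm_eq_inner inner_commute[of v 1] flip: qRe_eq_inner_one)
  qed
  then have "2 * (c \<bullet> b) = (norm b)\<^sup>2"
    using v(1) by (simp add: c_def inner_add_left flip: qRe_eq_inner_one)
      (simp add: diff_divide_distrib)
  then have "b \<in> sphere c (norm c)"
    unfolding mem_sphere_inner[OF norm_ge_zero]
    by (simp add: inner_diff_left inner_diff_right inner_commute power2_norm_eq_inner)
  moreover obtain w where w: "(\<zeta> + \<delta>, w) \<in> heis"
    "chain_shadow (\<zeta>, ((norm \<zeta>)\<^sup>2 / 2) *\<^sub>R 1) (\<zeta> + \<delta>, w) = (\<lambda>b. \<zeta> + \<delta> \<star> b) ` sphere c (norm c)"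
    using chain_with_centre[OF heis_lift d c] .
  ultimately have "base (\<zeta> + \<delta> \<star> b) \<in> base ` chain_shadow (\<zeta>, ((norm \<zeta>)\<^sup>2 / 2) *\<^sub>R 1) (\<zeta> + \<delta>, w)"
    by blast
  then have "base (\<zeta> + \<delta> \<star> b) \<in> chain_shadow (h (\<zeta>, ((norm \<zeta>)\<^sup>2 / 2) *\<^sub>R 1)) (h (\<zeta> + \<delta>, w))"
    using base_shadow[OF heis_lift w(1)] d by simp
  then show ?thesis
    unfolding chain_shadow_def cochain_def
    using fst_h[OF heis_lift[of \<zeta>]] fst_h[OF w(1)] by auto
qed

text \<open>A nonzero real parameter is collinear with 0 and 1, so it is reached in two nonreal
  steps: first to the direction \<open>\<delta> \<star> quat_i\<close>, then along that
  direction.\<close>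

lemma base_maps_line:
  assumes d: "\<delta> \<noteq> 0"
  shows "\<exists>b'. base (\<zeta> + \<delta> \<star> b) = base \<zeta> + (base (\<zeta> + \<delta>) - base \<zeta>) \<star> b'"
proof (cases "b = qRe b *\<^sub>R 1")
  case True
  show ?thesis
  proof (cases "b = 0")
    case True
    then show ?thesis by (auto intro: exI[of _ 0])
  next
    case False
    have "quat_i \<noteq> qRe quat_i *\<^sub>R 1"
      by (simp add: quat_i_def scaleR_quat_def one_quat_def)
    then obtain a where a: "base (\<zeta> + \<delta> \<star> quat_i) = base \<zeta> + (base (\<zeta> + \<delta>) - base \<zeta>) \<star> a"
      using base_maps_line_nonreal[OF d] by blast
    have "quat_i \<noteq> 0" by (simp add: quat_i_def zero_quat_def)
    then have di: "\<delta> \<star> quat_i \<noteq> 0" using d by (simp add: rmul_eq_0_iff)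
    \<comment> \<open>Chosen so that \<open>quat_i * b1\<close> is the real parameter
      \<open>b\<close>.\<close>
    define b1 where "b1 = - (qRe b *\<^sub>R quat_i)"
    have "qRe b \<noteq> 0" using True False by (metis scaleR_zero_left)
    then have "b1 \<noteq> qRe b1 *\<^sub>R 1"
      by (simp add: b1_def quat_i_def scaleR_quat_def one_quat_def uminus_quat_def)
    then obtain b2 where b2: "base (\<zeta> + \<delta> \<star> quat_i \<star> b1) = base \<zeta> + (base (\<zeta> + \<delta> \<star> quat_i) - base \<zeta>) \<star> b2"
      using base_maps_line_nonreal[OF di] by blast
    have "\<delta> \<star> quat_i \<star> b1 = \<delta> \<star> b"
      using True by (simp add: b1_def rmul_assoc quat_units_mult del: rmul_simps(6)) 
    then show ?thesis using a b2 by (auto simp: rmul_assoc)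
  qed
next
  case False
  then show ?thesis using base_maps_line_nonreal[OF d] by blast
qed

lemma line_map_sphere:
  assumes d: "\<delta> \<noteq> 0" and \<psi>: "\<And>b. base (\<zeta> + \<delta> \<star> b) = base \<zeta> + (base (\<zeta> + \<delta>) - base \<zeta>) \<star> \<psi> b"
    and S: "is_sphere S"
  shows "is_sphere (\<psi> ` S)"
proof -
  define D where "D = base (\<zeta> + \<delta>) - base \<zeta>"
  have D: "D \<noteq> 0" using d inj_base by (auto simp: D_def inj_eq)
  obtain c r where r: "0 < r" "S = sphere c r" using S by (auto simp: is_sphere_def)
  obtain x y where xy: "x \<in> heis" "y \<in> heis" "fst x \<noteq> fst y"
    "fst x = \<zeta> + \<delta> \<star> (c - r *\<^sub>R 1)" "fst y = \<zeta> + \<delta> \<star> (c + r *\<^sub>R 1)"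
    "chain_shadow x y = (\<lambda>b. \<zeta> + \<delta> \<star> b) ` S"
    using chain_over_sphere[OF d r(1)] r(2) by metis
  have "fst (h x) = base \<zeta> + D \<star> \<psi> (c - r *\<^sub>R 1)" "fst (h y) = base \<zeta> + D \<star> \<psi> (c + r *\<^sub>R 1)"
    using xy \<psi> by (simp_all add: fst_h D_def)
  moreover have "fst (h x) \<noteq> fst (h y)" using vertical xy by simp
  ultimately obtain S' where S': "is_sphere S'" "chain_shadow (h x) (h y) = (\<lambda>b. base \<zeta> + D \<star> b) ` S'"
    using chain_shadow_in_line h_heis xy(1,2) by metis
  have "(\<lambda>b. base \<zeta> + D \<star> b) ` (\<psi> ` S) = (\<lambda>b. base \<zeta> + D \<star> b) ` S'"
    using base_shadow[OF xy(1-3)] S'(2) \<psi> unfolding xy(6) by (simp add: image_image D_def)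
  moreover have "inj (\<lambda>b. base \<zeta> + D \<star> b)" using D by (auto simp: inj_def rmul_cancel_left)
  ultimately have "\<psi> ` S = S'" by (simp add: inj_image_eq_iff)
  then show ?thesis using S'(1) by simp
qed

text \<open>The line parameter is transformed by a bijection preserving spheres both ways, the
  backward direction coming from \<open>inverse_map\<close>. It fixes 0, hence is a linear
  similarity, and fixing 1 makes it an isometry.\<close>

lemma base_on_line:
  assumes d: "\<delta> \<noteq> 0"
  obtains \<psi> where "linear \<psi>" "\<And>b. norm (\<psi> b) = norm b" "\<psi> 1 = 1" "bij \<psi>"
    "\<And>b. base (\<zeta> + \<delta> \<star> b) = base \<zeta> + (base (\<zeta> + \<delta>) - base \<zeta>) \<star> \<psi> b"
proof -
  define D where "D = base (\<zeta> + \<delta>) - base \<zeta>"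
  have D: "D \<noteq> 0" using d inj_base by (auto simp: D_def inj_eq)
  obtain \<psi> where \<psi>: "\<And>b. base (\<zeta> + \<delta> \<star> b) = base \<zeta> + D \<star> \<psi> b"
    using base_maps_line[OF d, of \<zeta>] unfolding D_def by metis
  interpret inv: heis_map "inv_into heis h" by (rule inverse_map)
  have end_pts: "inv.base (base \<zeta>) = \<zeta>" "inv.base (base \<zeta> + D) = \<zeta> + \<delta>"
    using inverse_base by (simp_all add: D_def)
  obtain \<psi>' where \<psi>': "\<And>b. inv.base (base \<zeta> + D \<star> b) = \<zeta> + \<delta> \<star> \<psi>' b"
    using inv.base_maps_line[OF D, of "base \<zeta>"] unfolding end_pts by simp metis
  have left: "\<psi>' (\<psi> b) = b" for b
  proof -
    have "\<zeta> + \<delta> \<star> \<psi>' (\<psi> b) = \<zeta> + \<delta> \<star> b" using \<psi>'[of "\<psi> b"] \<psi>[of b] inverse_base[of "\<zeta> + \<delta> \<star> b"] by simp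
    then show ?thesis using d by (simp add: rmul_cancel_left)
  qed
  have right: "\<psi> (\<psi>' b) = b" for b
  proof -
    have "base (\<zeta> + \<delta> \<star> \<psi>' b) = base \<zeta> + D \<star> b"
      using \<psi>'[of b] base_inverse[of "base \<zeta> + D \<star> b"] by simp
    then have "base \<zeta> + D \<star> \<psi> (\<psi>' b) = base \<zeta> + D \<star> b" using \<psi>[of "\<psi>' b"] by simp
    then show ?thesis using D by (simp add: rmul_cancel_left)
  qed
  have bij: "bij \<psi>" unfolding bij_def using left right by (metis injI surjI)
  have fwd: "is_sphere (\<psi> ` S)" if "is_sphere S" for S
    using line_map_sphere[OF d _ that, of \<zeta> \<psi>] \<psi> by (simp add: D_def)
  have bwd: "is_sphere (\<psi>' ` S)" if "is_sphere S" for S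
    using inv.line_map_sphere[OF D _ that, of "base \<zeta>" \<psi>'] \<psi>' by (simp add: end_pts)
  interpret sb: sphere_bij \<psi>
  proof
    show "bij \<psi>" by (rule bij)
    show "is_sphere (\<psi> ` S) = is_sphere S" for S
      using fwd[of S] bwd[of "\<psi> ` S"] by (auto simp: image_image left)
  qed
  have zero: "\<psi> 0 = 0" using \<psi>[of 0] D by (simp add: rmul_eq_0_iff)
  have "D \<star> \<psi> 1 = D \<star> 1" using \<psi>[of 1] by (simp add: D_def algebra_simps)
  then have one: "\<psi> 1 = 1" unfolding rmul_cancel_left[OF D] .
  have orth: "(1::quat) \<noteq> 0" "quat_i \<noteq> 0" "1 \<bullet> quat_i = 0"
    by (simp_all add: quat_i_def inner_quat_def quat_arith_defs)
  have lin: "linear \<psi>" by (rule sb.linear_similarity[OF orth zero])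
  obtain k where k: "\<And>x. norm (\<psi> x) = k * norm x" using sb.linear_similarity[OF orth zero] by blast
  have "k = 1" using k[of 1] one by simp
  then show thesis using that lin k one bij \<psi> unfolding D_def by simp
qed


text \<open>The structure is extracted from \<open>slope\<close>: varying \<open>u\<close> over a
  fixed \<open>\<zeta>\<close> frees \<open>L\<close> and \<open>\<Phi>\<close> from
  \<open>\<delta>\<close>, and starting at the origin computes the second component of
  \<open>h\<close>.\<close>

theorem normal_form:
  assumes origin: "h (0, 0) = (0, 0)"
  obtains k \<phi> where "0 < k" "linear \<phi>" "\<phi> 1 = 1" "\<And>a b. \<phi> (a * b) = \<phi> a * \<phi> b"
    "\<And>x. x \<in> heis \<Longrightarrow> h x = (base (fst x), k\<^sup>2 *\<^sub>R \<phi> (snd x))"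
    "\<And>\<zeta> \<eta>. base (\<zeta> + \<eta>) = base \<zeta> + base \<eta>"
    "\<And>\<zeta> b. base (\<zeta> \<star> b) = base \<zeta> \<star> \<phi> b"
    "\<And>\<zeta>. norm (base \<zeta>) = k * norm \<zeta>"
proof -
  have zero_heis: "(0, 0) \<in> heis" by (simp add: heis_def)
  have base0: "base 0 = 0" using fst_h[OF zero_heis] origin by simp
  \<comment> \<open>On the line through \<open>\<zeta>\<close> and \<open>\<eta>\<close> the
    parameter map is linear and fixes 1, so it fixes 1/2.\<close>
  have mid: "base ((1/2) *\<^sub>R (\<zeta> + \<eta>)) = (1/2) *\<^sub>R (base \<zeta> + base \<eta>)" for \<zeta> \<eta>
  proof (cases "\<zeta> = \<eta>")
    case True
    then show ?thesis by (simp flip: scaleR_2)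
  next
    case False
    then obtain \<psi> where \<psi>: "linear \<psi>" "\<psi> 1 = 1"
      "\<And>b. base (\<zeta> + (\<eta> - \<zeta>) \<star> b) = base \<zeta> + (base (\<zeta> + (\<eta> - \<zeta>)) - base \<zeta>) \<star> \<psi> b"
      using base_on_line[of "\<eta> - \<zeta>" \<zeta>] by (metis eq_iff_diff_eq_0)
    have half: "x + (1/2) *\<^sub>R (y - x) = (1/2) *\<^sub>R (x + y)" for x y :: "quat ^ 'm"
      by (simp add: vec_eq_iff quat_eq_iff quat_arith_defs scaleR_quat_def field_simps)
    have "\<psi> ((1/2) *\<^sub>R 1) = (1/2) *\<^sub>R 1" using \<psi>(1,2) by (simp only: linear_scale)
    then show ?thesis using \<psi>(3)[of "(1/2) *\<^sub>R 1"] by (simp add: half)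
  qed
  have base_half: "base ((1/2) *\<^sub>R \<zeta>) = (1/2) *\<^sub>R base \<zeta>" for \<zeta>
    using mid[of \<zeta> 0] base0 by simp
  have add: "base (\<zeta> + \<eta>) = base \<zeta> + base \<eta>" for \<zeta> \<eta>
    using mid[of \<zeta> \<eta>] base_half[of "\<zeta> + \<eta>"] by simp
  have base_nz: "base \<delta> \<noteq> 0" if "\<delta> \<noteq> 0" for \<delta>
    using that inj_base base0 by (metis inj_eq)
  have "\<exists>\<phi>. linear \<phi> \<and> (\<forall>b. norm (\<phi> b) = norm b) \<and> \<phi> 1 = 1 \<and> bij \<phi> \<and>
    (\<forall>b. base (\<delta> \<star> b) = base \<delta> \<star> \<phi> b)" if d: "\<delta> \<noteq> 0" for \<delta>
  proof -
    obtain \<psi> where "linear \<psi>" "\<And>b. norm (\<psi> b) = norm b" "\<psi> 1 = 1" "bij \<psi>"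
      "\<And>b. base (0 + \<delta> \<star> b) = base 0 + (base (0 + \<delta>) - base 0) \<star> \<psi> b"
      using base_on_line[OF d, of 0] by blast
    then show ?thesis by (intro exI[of _ \<psi>]) (simp add: base0)
  qed
  then have "\<forall>\<delta>. \<exists>\<phi>. \<delta> \<noteq> 0 \<longrightarrow> linear \<phi> \<and> (\<forall>b. norm (\<phi> b) = norm b) \<and> \<phi> 1 = 1 \<and> bij \<phi> \<and>
    (\<forall>b. base (\<delta> \<star> b) = base \<delta> \<star> \<phi> b)" by blast
  from choice[OF this] obtain \<Phi> where "\<forall>\<delta>. \<delta> \<noteq> 0 \<longrightarrow> linear (\<Phi> \<delta>) \<and> (\<forall>b. norm (\<Phi> \<delta> b) = norm b) \<and>
    \<Phi> \<delta> 1 = 1 \<and> bij (\<Phi> \<delta>) \<and> (\<forall>b. base (\<delta> \<star> b) = base \<delta> \<star> \<Phi> \<delta> b)" by blast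
  then have \<Phi>: "\<And>\<delta>. \<delta> \<noteq> 0 \<Longrightarrow> linear (\<Phi> \<delta>)" "\<And>\<delta> b. \<delta> \<noteq> 0 \<Longrightarrow> norm (\<Phi> \<delta> b) = norm b"
    "\<And>\<delta>. \<delta> \<noteq> 0 \<Longrightarrow> \<Phi> \<delta> 1 = 1" "\<And>\<delta>. \<delta> \<noteq> 0 \<Longrightarrow> bij (\<Phi> \<delta>)"
    "\<And>\<delta> b. \<delta> \<noteq> 0 \<Longrightarrow> base (\<delta> \<star> b) = base \<delta> \<star> \<Phi> \<delta> b"
    by blast+
  define L where "L \<delta> = (norm (base \<delta>) / norm \<delta>)\<^sup>2" for \<delta>
  have slope: "snd (h (\<zeta> + \<delta>, w)) - snd (h (\<zeta>, u)) - herm (base \<zeta>) (base \<delta>)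
      = L \<delta> *\<^sub>R \<Phi> \<delta> (w - u - herm \<zeta> \<delta>)"
    if d: "\<delta> \<noteq> 0" and x: "(\<zeta>, u) \<in> heis" and y: "(\<zeta> + \<delta>, w) \<in> heis" for \<zeta> \<delta> u w
  proof -
    note lin = \<Phi>(1)[OF d] and iso = \<Phi>(2)[OF d]
    define u' where "u' = snd (h (\<zeta>, u))"
    define w' where "w' = snd (h (\<zeta> + \<delta>, w))"
    define e where "e = w - u - herm \<zeta> \<delta>"
    define e' where "e' = w' - u' - herm (base \<zeta>) (base \<delta>)"
    define c where "c = shadow_centre \<delta> e"
    define c' where "c' = shadow_centre (base \<delta>) e'"
    note d' = base_nz[OF d]
    have hx: "h (\<zeta>, u) = (base \<zeta>, u')" and hy: "h (\<zeta> + \<delta>, w) = (base \<zeta> + base \<delta>, w')"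
      using fst_h[OF x] fst_h[OF y] by (simp_all add: u'_def w'_def add prod_eq_iff)
    have x': "(base \<zeta>, u') \<in> heis" using h_heis[OF x] hx by simp
    have "base ` chain_shadow (\<zeta>, u) (\<zeta> + \<delta>, w) = chain_shadow (base \<zeta>, u') (base \<zeta> + base \<delta>, w')"
      using base_shadow[OF x y] d hx hy by simp
    moreover have "chain_shadow (\<zeta>, u) (\<zeta> + \<delta>, w) = (\<lambda>b. \<zeta> + \<delta> \<star> b) ` sphere c (norm c)"
      by (rule chain_shadow_eq[OF x d]) (simp add: c_def e_def)
    moreover have "chain_shadow (base \<zeta>, u') (base \<zeta> + base \<delta>, w')
        = (\<lambda>b. base \<zeta> + base \<delta> \<star> b) ` sphere c' (norm c')"
      by (rule chain_shadow_eq[OF x' d']) (simp add: c'_def e'_def)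
    ultimately have "(\<lambda>b. base \<zeta> + base \<delta> \<star> b) ` (\<Phi> \<delta> ` sphere c (norm c))
        = (\<lambda>b. base \<zeta> + base \<delta> \<star> b) ` sphere c' (norm c')"
      by (simp add: image_image add \<Phi>(5)[OF d])
    moreover have "inj (\<lambda>b. base \<zeta> + base \<delta> \<star> b)" using d' by (auto simp: inj_def rmul_cancel_left)
    ultimately have im: "\<Phi> \<delta> ` sphere c (norm c) = sphere c' (norm c')" by (simp add: inj_image_eq_iff)
    have dist: "dist (\<Phi> \<delta> a) (\<Phi> \<delta> b) = dist a b" for a b
      using iso[of "a - b"] lin by (simp add: dist_norm linear_diff)
    have "\<Phi> \<delta> ` sphere c (norm c) = sphere (\<Phi> \<delta> c) (norm c)"
    proof
      show "sphere (\<Phi> \<delta> c) (norm c) \<subseteq> \<Phi> \<delta> ` sphere c (norm c)"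
      proof
        fix z assume z: "z \<in> sphere (\<Phi> \<delta> c) (norm c)"
        obtain b where "z = \<Phi> \<delta> b" using \<Phi>(4)[OF d] by (metis bij_pointE)
        then show "z \<in> \<Phi> \<delta> ` sphere c (norm c)" using z dist by auto
      qed
    qed (auto simp: dist)
    then have "sphere (\<Phi> \<delta> c) (norm c) = sphere c' (norm c')" using im by simp
    moreover have "0 < norm c" using shadow_centre_nonzero[OF x y d] by (simp add: c_def e_def)
    ultimately have cc': "c' = \<Phi> \<delta> c" using sphere_centre_unique by metis
    \<comment> \<open>By polarization the isometry preserves the inner product with 1, which is the
      real part.\<close>
    have re: "qRe (\<Phi> \<delta> a) = qRe a" for a
    proof -
      have "4 * (v \<bullet> w) = (norm (v + w))\<^sup>2 - (norm (v - w))\<^sup>2" for v w :: quat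
        by (simp add: power2_norm_eq_inner inner_add_left inner_add_right inner_diff_left inner_diff_right inner_commute)
      from this[of "\<Phi> \<delta> 1" "\<Phi> \<delta> a"] this[of 1 a] have "\<Phi> \<delta> 1 \<bullet> \<Phi> \<delta> a = 1 \<bullet> a"
        using lin iso by (simp flip: linear_add linear_diff)
      then show ?thesis using \<Phi>(3)[OF d] by (simp add: qRe_eq_inner_one)
    qed
    have cnj: "\<Phi> \<delta> (qcnj a) = qcnj (\<Phi> \<delta> a)" for a
      unfolding qcnj_eq re linear_diff[OF lin] linear_scale[OF lin] \<Phi>(3)[OF d] ..
    have "(1 / (norm (base \<delta>))\<^sup>2) *\<^sub>R e' = qcnj c'" by (simp add: c'_def shadow_centre_def)
    also have "\<dots> = (1 / (norm \<delta>)\<^sup>2) *\<^sub>R \<Phi> \<delta> e"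
      unfolding cc' cnj[symmetric] by (simp add: c_def shadow_centre_def linear_scale[OF lin])
    finally have "(norm (base \<delta>))\<^sup>2 *\<^sub>R ((1 / (norm (base \<delta>))\<^sup>2) *\<^sub>R e')
        = (norm (base \<delta>))\<^sup>2 *\<^sub>R ((1 / (norm \<delta>)\<^sup>2) *\<^sub>R \<Phi> \<delta> e)" by simp
    then have "e' = L \<delta> *\<^sub>R \<Phi> \<delta> e" using d' by (simp add: L_def power_divide)
    then show ?thesis by (simp add: e_def e'_def u'_def w'_def)
  qed
  \<comment> \<open>Two instances of \<open>slope\<close> with a common end point over
    \<open>\<zeta> + \<delta>\<close> are subtracted; the Hermitian terms cancel. Since
    \<open>v\<close> is imaginary, \<open>(\<zeta>, u + v)\<close> stays in
    \<open>heis\<close>.\<close>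
  have vert: "snd (h (\<zeta>, u + v)) - snd (h (\<zeta>, u)) = L \<delta> *\<^sub>R \<Phi> \<delta> v"
    if d: "\<delta> \<noteq> 0" and x: "(\<zeta>, u) \<in> heis" and v: "qRe v = 0" for \<zeta> u v \<delta>
  proof -
    let ?y = "(\<zeta> + \<delta>, ((norm (\<zeta> + \<delta>))\<^sup>2 / 2) *\<^sub>R 1) :: (quat ^ 'm) \<times> quat"
    have x': "(\<zeta>, u + v) \<in> heis" using x v by (simp add: heis_def)
    have "snd (h (\<zeta>, u + v)) - snd (h (\<zeta>, u)) =
      (snd (h ?y) - snd (h (\<zeta>, u)) - herm (base \<zeta>) (base \<delta>)) -
      (snd (h ?y) - snd (h (\<zeta>, u + v)) - herm (base \<zeta>) (base \<delta>))" by simp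
    also have "\<dots> = L \<delta> *\<^sub>R \<Phi> \<delta> v"
      unfolding slope[OF d x heis_lift] slope[OF d x' heis_lift]
      by (simp flip: scaleR_diff_right linear_diff[OF \<Phi>(1)[OF d]])
    finally show ?thesis .
  qed
  obtain \<delta>0 :: "quat ^ 'm" where d0: "\<delta>0 \<noteq> 0" using exists_nonzero_vec by blast
  have LPhi: "L \<delta> *\<^sub>R \<Phi> \<delta> v = L \<delta>0 *\<^sub>R \<Phi> \<delta>0 v" if "\<delta> \<noteq> 0" "qRe v = 0" for \<delta> v
    using vert[OF that(1) zero_heis that(2)] vert[OF d0 zero_heis that(2)] by simp
  have L_nonneg: "0 \<le> L \<delta>" for \<delta> by (simp add: L_def)
  \<comment> \<open>Taking norms at an imaginary unit isolates \<open>L\<close>, because the maps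
    \<open>\<Phi> \<delta>\<close> are isometries.\<close>
  have Lc: "L \<delta> = L \<delta>0" if d: "\<delta> \<noteq> 0" for \<delta>
  proof -
    have "qRe quat_i = 0" "norm quat_i = 1"
      by (simp_all add: quat_i_def norm_quat_def inner_quat_def)
    then show ?thesis using arg_cong[OF LPhi[OF d, of quat_i], of norm] L_nonneg \<Phi>(2) d d0 by simp
  qed
  have Lpos: "0 < L \<delta>0" using d0 base_nz by (simp add: L_def)
  \<comment> \<open>The two maps agree on imaginary quaternions after cancelling the positive
    factor, and on real ones because both fix 1.\<close>
  have Phic: "\<Phi> \<delta> b = \<Phi> \<delta>0 b" if d: "\<delta> \<noteq> 0" for \<delta> b
  proof -
    define v where "v = b - qRe b *\<^sub>R 1"
    have b: "b = qRe b *\<^sub>R 1 + v" and v: "qRe v = 0" by (simp_all add: v_def)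
    have "\<Phi> \<delta> v = \<Phi> \<delta>0 v" using LPhi[OF d v] Lc[OF d] Lpos by simp
    moreover have "\<Phi> \<delta> b = qRe b *\<^sub>R 1 + \<Phi> \<delta> v" if "\<delta> \<noteq> 0" for \<delta>
      using arg_cong[OF b, of "\<Phi> \<delta>"] \<Phi>(1,3)[OF that] by (simp add: linear_add linear_scale)
    ultimately show ?thesis using d d0 by simp
  qed
  define \<phi> where "\<phi> = \<Phi> \<delta>0"
  define k where "k = sqrt (L \<delta>0)"
  have k2: "k\<^sup>2 = L \<delta>0" using Lpos by (simp add: k_def)
  have kpos: "0 < k" using Lpos by (simp add: k_def)
  have lin: "linear \<phi>" and one: "\<phi> 1 = 1" using \<Phi>(1,3)[OF d0] by (simp_all add: \<phi>_def)
  have rmul: "base (\<zeta> \<star> b) = base \<zeta> \<star> \<phi> b" for \<zeta> b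
    using \<Phi>(5)[of \<zeta> b] Phic[of \<zeta> b] by (cases "\<zeta> = 0") (simp_all add: base0 \<phi>_def)
  \<comment> \<open>The image of \<open>\<delta>0 \<star> (a * b)\<close> is computed in one step
    and in two; the second step uses that \<open>\<phi>\<close> also serves the direction
    \<open>\<delta>0 \<star> a\<close>.\<close>
  have mult: "\<phi> (a * b) = \<phi> a * \<phi> b" for a b
  proof -
    have "base \<delta>0 \<star> \<phi> (a * b) = base \<delta>0 \<star> (\<phi> a * \<phi> b)"
      using rmul[of \<delta>0 "a * b"] rmul[of "\<delta>0 \<star> a" b] rmul[of \<delta>0 a] by (simp add: rmul_assoc)
    then show ?thesis using rmul_cancel_left[OF base_nz[OF d0]] by blast
  qed
  have norm_base: "norm (base \<zeta>) = k * norm \<zeta>" for \<zeta>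
  proof (cases "\<zeta> = 0")
    case False
    have "k = norm (base \<zeta>) / norm \<zeta>" using Lc[OF False] by (simp add: k_def L_def real_sqrt_divide flip: Lc[OF False])
    then show ?thesis using False by simp
  qed (simp add: base0)
  have snd_h: "snd (h (\<zeta>, u)) = k\<^sup>2 *\<^sub>R \<phi> u" if x: "(\<zeta>, u) \<in> heis" for \<zeta> u
  proof (cases "\<zeta> = 0")
    case True
    then have "qRe u = 0" using x by (simp add: heis_def)
    then show ?thesis using vert[OF d0 zero_heis, of u] origin True by (simp add: k2 \<phi>_def)
  next
    case False
    have "(0 + \<zeta>, u) \<in> heis" using x by simp
    from slope[OF False zero_heis this] show ?thesis
      using origin Lc[OF False] Phic[OF False] by (simp add: base0 k2 \<phi>_def)
  qed
  have h_eq: "h x = (base (fst x), k\<^sup>2 *\<^sub>R \<phi> (snd x))" if "x \<in> heis" for x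
    using fst_h[OF that] snd_h[of "fst x" "snd x"] that by (simp add: prod_eq_iff)
  show thesis by (rule that[OF kpos lin one mult h_eq add rmul norm_base])
qed

end


section \<open>Boundary points and chains\<close>

lemma rscale_eq_rmul: "rscale v a = v \<star> a"
  by (simp add: rscale_def rmul_def)

definition hvec :: "quat \<Rightarrow> quat ^ 'm \<Rightarrow> quat \<Rightarrow> 'm::finite hvec" where
  "hvec a \<zeta> c = (\<chi> i. case i of First \<Rightarrow> a | Mid p \<Rightarrow> \<zeta> $ p | Last \<Rightarrow> c)"

lemma hvec_nth [simp]:
  "hvec a \<zeta> c $ First = a" "hvec a \<zeta> c $ Mid p = \<zeta> $ p" "hvec a \<zeta> c $ Last = c"
  by (simp_all add: hvec_def)

lemma hvec_eqI:
  fixes v w :: "'m::finite hvec"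
  assumes "v $ First = w $ First" "\<And>p. v $ Mid p = w $ Mid p" "v $ Last = w $ Last"
  shows "v = w"
  unfolding vec_eq_iff
proof
  show "v $ i = w $ i" for i using assms by (cases i) auto
qed

lemma hvec_inject [simp]: "hvec a \<zeta> c = hvec a' \<zeta>' c' \<longleftrightarrow> a = a' \<and> \<zeta> = \<zeta>' \<and> c = c'"
  by (metis hvec_nth vec_eq_iff)

lemma hvec_cases [cases type]:
  fixes v :: "'m::finite hvec"
  obtains a \<zeta> c where "v = hvec a \<zeta> c"
proof -
  have "v = hvec (v $ First) (\<chi> p. v $ Mid p) (v $ Last)" by (rule hvec_eqI) simp_all
  then show thesis by (rule that)
qed

lemma hvec_add: "hvec a \<zeta> c + hvec a' \<zeta>' c' = hvec (a + a') (\<zeta> + \<zeta>') (c + c')"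
  and hvec_rmul: "hvec a \<zeta> c \<star> b = hvec (a * b) (\<zeta> \<star> b) (c * b)"
  and hvec_zero: "0 = hvec 0 0 0"
  by (rule hvec_eqI; simp)+

lemma qform_hvec: "qform (hvec a \<zeta> c) = (norm \<zeta>)\<^sup>2 - 2 * qRe (qcnj a * c)"
  by (simp add: qform_def qtr_eq qnorm_eq_norm power2_norm_eq_inner inner_vec_def)

definition inf_point :: "'m::finite hvec set" where
  "inf_point = rline (hvec 0 0 1)"

definition fin_point :: "(quat ^ 'm::finite) \<times> quat \<Rightarrow> 'm hvec set" where
  "fin_point x = rline (hvec 1 (fst x) (snd x))"

lemma mem_rline: "w \<in> rline v \<longleftrightarrow> (\<exists>a. w = v \<star> a)"
  by (auto simp: rline_def rscale_eq_rmul)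

lemma rline_rmul: "a \<noteq> 0 \<Longrightarrow> rline (v \<star> a) = rline v"
proof
  assume a: "a \<noteq> 0"
  show "rline (v \<star> a) \<subseteq> rline v" by (auto simp: rline_def rscale_eq_rmul rmul_assoc)
  have "v \<star> b = v \<star> a \<star> (inverse a * b)" for b using a by (simp add: rmul_assoc flip: mult.assoc)
  then show "rline v \<subseteq> rline (v \<star> a)" unfolding subset_iff mem_rline by blast
qed

lemma self_mem_rline: "v \<in> rline v"
  by (auto simp: mem_rline intro: exI[of _ 1])

lemma fin_point_eq_iff: "fin_point x = fin_point y \<longleftrightarrow> x = y"
proof
  assume "fin_point x = fin_point y"
  then have "hvec 1 (fst x) (snd x) \<in> rline (hvec 1 (fst y) (snd y))"
    using self_mem_rline by (metis fin_point_def)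
  then show "x = y" by (auto simp: mem_rline hvec_rmul prod_eq_iff)
qed simp

lemma inf_point_neq_fin_point: "inf_point \<noteq> fin_point x"
proof
  assume "inf_point = fin_point x"
  then have "hvec 1 (fst x) (snd x) \<in> rline (hvec 0 0 1)"
    using self_mem_rline by (metis fin_point_def inf_point_def)
  then show False by (auto simp: mem_rline hvec_rmul)
qed

text \<open>With first coordinate 0 the form reduces to the squared norm of the middle block, which
  must vanish; otherwise the first coordinate is scaled to 1.\<close>

lemma hyp_boundary_eq: "hyp_boundary = insert inf_point (fin_point ` (heis :: ((quat ^ 'm::finite) \<times> quat) set))" (is "?L = ?R")
proof
  show "?L \<subseteq> ?R"
  proof
    fix X :: "'m hvec set" assume "X \<in> hyp_boundary"
    then obtain v where v: "X = rline v" "v \<noteq> 0" "qform v = 0" by (auto simp: hyp_boundary_def)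
    obtain a \<zeta> c where hv: "v = hvec a \<zeta> c" by (rule hvec_cases)
    show "X \<in> ?R"
    proof (cases "a = 0")
      case True
      then have "\<zeta> = 0" using v(3) by (simp add: hv qform_hvec)
      then have "c \<noteq> 0" "v = hvec 0 0 1 \<star> c" using v(2) True by (simp_all add: hv hvec_rmul hvec_zero)
      then show ?thesis using v(1) by (simp add: inf_point_def rline_rmul)
    next
      case False
      have w: "v \<star> inverse a = hvec 1 (\<zeta> \<star> inverse a) (c * inverse a)"
        using False by (simp add: hv hvec_rmul)
      have "X = fin_point (\<zeta> \<star> inverse a, c * inverse a)"
        using False rline_rmul[of "inverse a" v] v(1) by (simp add: fin_point_def w)
      moreover have "(\<zeta> \<star> inverse a, c * inverse a) \<in> heis"
        using v(3) qform_rscale[of v "inverse a"] by (simp add: rscale_eq_rmul w qform_hvec heis_def)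
      ultimately show ?thesis by blast
    qed
  qed
  show "?R \<subseteq> ?L"
    unfolding hyp_boundary_def inf_point_def fin_point_def
    by (auto simp: hvec_zero qform_hvec heis_def)
qed

lemma hyp_boundary_subset_proj_space: "hyp_boundary \<subseteq> proj_space"
  by (auto simp: hyp_boundary_def proj_space_def)

section \<open>Joins of points and the unique chain through two boundary points\<close>

definition join_span :: "'m::finite hvec set \<Rightarrow> 'm hvec set \<Rightarrow> 'm hvec set" where
  "join_span X Y = {s + t | s t. s \<in> X \<and> t \<in> Y}"

lemma join_span_rline: "join_span (rline u) (rline v) = right_span2 u v"
  by (auto simp: join_span_def right_span2_def rline_def)

lemma mem_right_span2: "w \<in> right_span2 u v \<longleftrightarrow> (\<exists>a b. w = u \<star> a + v \<star> b)"
  by (auto simp: right_span2_def rscale_eq_rmul)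

lemma right_span2_commute: "right_span2 u v = right_span2 v u"
  by (auto simp: right_span2_def) (metis add.commute)+

lemma rline_subset_right_span2: "rline w \<subseteq> right_span2 u v \<longleftrightarrow> w \<in> right_span2 u v"
proof
  assume "w \<in> right_span2 u v"
  then obtain a b where "w = u \<star> a + v \<star> b" by (auto simp: mem_right_span2)
  then have "w \<star> c = u \<star> (a * c) + v \<star> (b * c)" for c by (simp add: rmul_add_left rmul_assoc)
  then show "rline w \<subseteq> right_span2 u v"
    unfolding subset_iff mem_right_span2 mem_rline by blast
qed (use self_mem_rline in blast)

text \<open>The Steinitz exchange step over a division ring, with scalars kept on the right.\<close>

lemma right_span2_exchange:
  assumes "a \<noteq> 0"
  shows "right_span2 (u \<star> a + v \<star> b) v = right_span2 u v"
proof
  show "right_span2 (u \<star> a + v \<star> b) v \<subseteq> right_span2 u v"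
  proof
    fix w assume "w \<in> right_span2 (u \<star> a + v \<star> b) v"
    then obtain s t where "w = (u \<star> a + v \<star> b) \<star> s + v \<star> t" by (auto simp: mem_right_span2)
    then have "w = u \<star> (a * s) + v \<star> (b * s + t)" by (simp add: rmul_distribs rmul_assoc)
    then show "w \<in> right_span2 u v" unfolding mem_right_span2 by blast
  qed
  show "right_span2 u v \<subseteq> right_span2 (u \<star> a + v \<star> b) v"
  proof
    fix w assume "w \<in> right_span2 u v"
    then obtain s t where "w = u \<star> s + v \<star> t" by (auto simp: mem_right_span2)
    then have "w = (u \<star> a + v \<star> b) \<star> (inverse a * s) + v \<star> (t - b * inverse a * s)"
      using assms by (simp add: rmul_distribs rmul_assoc) (simp flip: mult.assoc)
    then show "w \<in> right_span2 (u \<star> a + v \<star> b) v" unfolding mem_right_span2 by blast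
  qed
qed

lemma right_span2_unique_aux:
  assumes ind: "right_indep u v" and u: "u = a \<star> s + b \<star> t" and s: "s \<noteq> 0"
    and v: "v \<in> right_span2 a b"
  shows "right_span2 a b = right_span2 u v"
proof -
  have ab: "right_span2 a b = right_span2 u b" unfolding u using right_span2_exchange[OF s, of a b t] by simp
  then obtain p q where vpq: "v = u \<star> p + b \<star> q" using v by (auto simp: mem_right_span2)
  have "q \<noteq> 0"
  proof
    assume "q = 0"
    then have "rscale u p + rscale v (- 1) = 0" by (simp add: vpq rscale_eq_rmul)
    then have "- 1 = (0 :: quat)" using ind unfolding right_indep_def by blast
    then show False by simp
  qed
  then have "right_span2 b u = right_span2 v u"
    unfolding vpq using right_span2_exchange[of q b u p] by (simp add: add.commute)
  then show ?thesis using ab right_span2_commute by metis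
qed

lemma right_span2_unique:
  assumes ind: "right_indep u v" and u: "u \<in> right_span2 a b" and v: "v \<in> right_span2 a b"
  shows "right_span2 a b = right_span2 u v"
proof -
  obtain s t where st: "u = a \<star> s + b \<star> t" using u by (auto simp: mem_right_span2)
  have "s \<noteq> 0 \<or> t \<noteq> 0"
  proof (rule ccontr)
    assume "\<not> (s \<noteq> 0 \<or> t \<noteq> 0)"
    then have "rscale u 1 + rscale v 0 = 0" by (simp add: st rscale_eq_rmul)
    then have "1 = (0 :: quat)" using ind unfolding right_indep_def by blast
    then show False by simp
  qed
  then show ?thesis
  proof
    assume "s \<noteq> 0"
    then show ?thesis using right_span2_unique_aux[OF ind st _ v] by blast
  next
    assume "t \<noteq> 0"
    then show ?thesis using right_span2_unique_aux[OF ind, of b t a s] st v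
      by (simp add: add.commute right_span2_commute[of a b])
  qed
qed

lemma right_indep_of_distinct_lines:
  assumes "u \<noteq> 0" "v \<noteq> 0" "rline u \<noteq> rline v"
  shows "right_indep u v"
  unfolding right_indep_def
proof (intro allI impI)
  fix a b assume eq: "rscale u a + rscale v b = 0"
  then have ab: "u \<star> a = - (v \<star> b)" by (simp add: rscale_eq_rmul add_eq_0_iff2)
  have "a = 0"
  proof (rule ccontr)
    assume a: "a \<noteq> 0"
    have "u = u \<star> a \<star> inverse a" using a by (simp add: rmul_assoc)
    then have u: "u = v \<star> (- b * inverse a)" by (simp add: ab rmul_assoc)
    then have "- b * inverse a \<noteq> 0" using assms(1) by auto
    then show False using rline_rmul u assms(3) by metis
  qed
  then show "a = 0 \<and> b = 0" using ab assms(2) by (simp add: rmul_eq_0_iff)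
qed

text \<open>Supplies the meeting with hyperbolic space that \<open>chain\<close> demands. On a
  vertical line raise the last coordinate by 1; for points with different first components take the
  midpoint, where the parallelogram law gives a negative value.\<close>

lemma join_span_contains_negative:
  fixes X :: "'m::finite hvec set"
  assumes "X \<in> hyp_boundary" "Y \<in> hyp_boundary" "X \<noteq> Y"
  shows "\<exists>w \<in> join_span X Y. qform w < 0"
proof -
  have inf: "\<exists>w \<in> join_span inf_point (fin_point x). qform w < 0" if "x \<in> heis" for x :: "(quat ^ 'm) \<times> quat"
  proof
    show "hvec 0 0 1 + hvec 1 (fst x) (snd x) \<in> join_span inf_point (fin_point x)"
      unfolding join_span_def inf_point_def fin_point_def using self_mem_rline by blast
    show "qform (hvec 0 0 1 + hvec 1 (fst x) (snd x)) < 0"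
      using that by (simp add: hvec_add qform_hvec heis_def)
  qed
  have comm: "join_span X Y = join_span Y X" for X Y :: "'m hvec set" by (auto simp: join_span_def) (metis add.commute)+
  have fin: "\<exists>w \<in> join_span (fin_point x) (fin_point y). qform w < 0"
    if x: "x \<in> heis" and y: "y \<in> heis" and ne: "x \<noteq> y" for x y :: "(quat ^ 'm) \<times> quat"
  proof (cases "fst x = fst y")
    case True
    define b where "b = inverse (snd x - snd y)"
    have "snd x - snd y \<noteq> 0" using ne True by (simp add: prod_eq_iff)
    then have b: "(snd x - snd y) * b = 1" by (simp add: b_def)
    let ?w = "hvec 1 (fst x) (snd x) \<star> (1 + b) + hvec 1 (fst y) (snd y) \<star> (- b)"
    have "?w = hvec 1 (fst x) (snd x + (snd x - snd y) * b)"
      using True by (simp add: hvec_rmul hvec_add rmul_distribs algebra_simps)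
    then have "qform ?w < 0" using x by (simp add: b qform_hvec heis_def)
    then show ?thesis unfolding join_span_def fin_point_def using mem_rline by blast
  next
    case False
    let ?w = "hvec 1 (fst x) (snd x) \<star> ((1/2) *\<^sub>R 1) + hvec 1 (fst y) (snd y) \<star> ((1/2) *\<^sub>R 1)"
    have w: "?w = hvec 1 ((1/2) *\<^sub>R (fst x + fst y)) ((1/2) *\<^sub>R (snd x + snd y))"
      by (rule hvec_eqI) (simp_all add: scaleR_right_distrib flip: scaleR_left_distrib)
    have "qform ?w = (norm ((1/2) *\<^sub>R (fst x + fst y)))\<^sup>2 - (qRe (snd x) + qRe (snd y))"
      unfolding w qform_hvec by (simp add: add_divide_distrib)
    also have "\<dots> = - ((norm (fst x - fst y))\<^sup>2 / 4)"
    proof -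
      have "qRe (snd x) + qRe (snd y) = ((norm (fst x))\<^sup>2 + (norm (fst y))\<^sup>2) / 2"
        using x y by (simp add: heis_def)
      then show ?thesis by (simp add: power2_norm_eq_inner inner_add_left inner_add_right
            inner_diff_left inner_diff_right inner_commute field_simps)
    qed
    also have "\<dots> < 0" using False by simp
    finally show ?thesis unfolding join_span_def fin_point_def using mem_rline by blast
  qed
  from assms(1,2) consider "X = inf_point" "Y = inf_point" | x where "X = inf_point" "Y = fin_point x" "x \<in> heis"
    | x where "X = fin_point x" "Y = inf_point" "x \<in> heis"
    | x y where "X = fin_point x" "Y = fin_point y" "x \<in> heis" "y \<in> heis"
    unfolding hyp_boundary_eq by blast
  then show ?thesis
  proof cases
    case 3
    then show ?thesis using inf comm by metis
  qed (use assms(3) inf fin in \<open>simp_all add: fin_point_eq_iff\<close>)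
qed

text \<open>The plane of a projective line through \<open>X\<close> and \<open>Y\<close> must be
  their span, and this span contains a negative vector, so it does define a chain.\<close>

lemma chain_through_iff:
  assumes X: "X \<in> hyp_boundary" and Y: "Y \<in> hyp_boundary" and ne: "X \<noteq> Y"
  shows "chain C \<and> X \<in> C \<and> Y \<in> C \<longleftrightarrow> C = {Z \<in> hyp_boundary. Z \<subseteq> join_span X Y}"
proof -
  obtain u v where u: "X = rline u" "u \<noteq> 0" and v: "Y = rline v" "v \<noteq> 0"
    using X Y by (auto simp: hyp_boundary_def)
  have ind: "right_indep u v" using right_indep_of_distinct_lines u v ne by simp
  have j: "join_span X Y = right_span2 u v" by (simp add: u v join_span_rline)
  have mem: "u \<in> right_span2 u v" "v \<in> right_span2 u v"
    unfolding mem_right_span2 by (rule exI[of _ 1] exI[of _ 0], rule exI[of _ 0] exI[of _ 1], simp)+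
  show ?thesis
  proof
    assume C: "chain C \<and> X \<in> C \<and> Y \<in> C"
    then obtain a b where L: "C = {Z \<in> proj_space. Z \<subseteq> right_span2 a b} \<inter> hyp_boundary"
      unfolding chain_def proj_line_def by blast
    have "right_span2 a b = right_span2 u v"
      using C by (intro right_span2_unique[OF ind]) (auto simp: L u v rline_subset_right_span2)
    then show "C = {Z \<in> hyp_boundary. Z \<subseteq> join_span X Y}"
      using L hyp_boundary_subset_proj_space j by auto
  next
    assume C: "C = {Z \<in> hyp_boundary. Z \<subseteq> join_span X Y}"
    define L where "L = {Z \<in> proj_space. Z \<subseteq> right_span2 u v}"
    obtain w where w: "w \<in> right_span2 u v" "qform w < 0"
      using join_span_contains_negative[OF X Y ne] j by blast
    have "w \<noteq> 0" using w(2) by (auto simp: hvec_zero qform_hvec)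
    then have "rline w \<in> L \<inter> hyp_space"
      using w by (auto simp: L_def proj_space_def hyp_space_def rline_subset_right_span2)
    moreover have "proj_line L" unfolding proj_line_def L_def using ind by blast
    moreover have "C = L \<inter> hyp_boundary"
      unfolding C L_def j using hyp_boundary_subset_proj_space by blast
    moreover have "X \<in> C" "Y \<in> C" unfolding C j using X Y mem by (simp_all add: u v rline_subset_right_span2)
    ultimately show "chain C \<and> X \<in> C \<and> Y \<in> C" unfolding chain_def by blast
  qed
qed

text \<open>Two boundary points lie on a unique chain, so a bijection mapping chains to chains also
  pulls chains back to chains.\<close>

lemma join_span_iff_of_chain_map:
  fixes f :: "'m::finite hvec set \<Rightarrow> 'm hvec set"
  assumes bij: "bij_betw f hyp_boundary hyp_boundary" and ch: "\<And>C. chain C \<Longrightarrow> chain (f ` C)"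
    and X: "X \<in> hyp_boundary" and Y: "Y \<in> hyp_boundary" and Z: "Z \<in> hyp_boundary" and ne: "X \<noteq> Y"
  shows "f Z \<subseteq> join_span (f X) (f Y) \<longleftrightarrow> Z \<subseteq> join_span X Y"
proof -
  define C where "C = {Z \<in> hyp_boundary. Z \<subseteq> join_span X Y}"
  have C: "chain C" "X \<in> C" "Y \<in> C" using chain_through_iff[OF X Y ne, of C] by (simp_all add: C_def)
  have inj: "inj_on f hyp_boundary" using bij by (simp add: bij_betw_def)
  have im: "f X \<in> hyp_boundary" "f Y \<in> hyp_boundary" "f Z \<in> hyp_boundary"
    using bij X Y Z by (auto simp: bij_betw_def)
  have ne': "f X \<noteq> f Y" using inj X Y ne by (auto dest: inj_onD)
  have "f ` C = {Z \<in> hyp_boundary. Z \<subseteq> join_span (f X) (f Y)}"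
    using chain_through_iff[OF im(1,2) ne', of "f ` C"] ch C by blast
  then have "f Z \<subseteq> join_span (f X) (f Y) \<longleftrightarrow> f Z \<in> f ` C" using im(3) by blast
  also have "\<dots> \<longleftrightarrow> Z \<in> C" using inj Z by (intro inj_on_image_mem_iff) (auto simp: C_def)
  finally show ?thesis using Z by (simp add: C_def)
qed


section \<open>The action of the unitary group\<close>

text \<open>As usual, the columns are the images of the standard basis vectors; left multiplication
  by a matrix commutes with right scalars.\<close>

lemma matrix_of_right_linear:
  fixes L :: "quat ^ 'n::finite \<Rightarrow> quat ^ 'n"
  assumes add: "\<And>v w. L (v + w) = L v + L w" and rmul: "\<And>v a. L (v \<star> a) = L v \<star> a"
  obtains g where "\<And>v. g *v v = L v"
proof
  fix v :: "quat ^ 'n"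
  have zero: "L 0 = 0" using rmul[of 0 0] by simp
  have sum: "L (sum F A) = (\<Sum>j\<in>A. L (F j))" if "finite A" for F and A :: "'n set"
    using that by (induction A) (simp_all add: zero add)
  have "v = (\<Sum>j\<in>UNIV. axis j 1 \<star> v $ j)"
    by (simp add: vec_eq_iff axis_def if_distrib[of "\<lambda>x. x * _"] cong: if_cong)
  then have "L v = (\<Sum>j\<in>UNIV. L (axis j 1) \<star> v $ j)"
    by (metis (no_types, lifting) rmul sum sum.cong finite)
  then show "(\<chi> i j. L (axis j 1) $ i) *v v = L v"
    by (simp add: vec_eq_iff matrix_vector_mult_def)
qed

text \<open>The inverse map is right linear too, and its matrix inverts that of
  \<open>L\<close>.\<close>

lemma U_q_of_right_linear:
  fixes L :: "'m::finite hvec \<Rightarrow> 'm hvec"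
  assumes add: "\<And>v w. L (v + w) = L v + L w" and rmul: "\<And>v a. L (v \<star> a) = L v \<star> a"
    and bij: "bij L" and form: "\<And>v. qform (L v) = qform v"
  obtains g where "g \<in> carrier U_q" "\<And>v. g *v v = L v"
proof -
  obtain g where g: "\<And>v. g *v v = L v" using matrix_of_right_linear[of L, OF add rmul] by blast
  define K where "K = inv_into UNIV L"
  have left: "K (L v) = v" and right: "L (K v) = v" for v
    using bij by (simp_all add: K_def bij_is_inj bij_is_surj surj_f_inv_f)
  have add': "K (v + w) = K v + K w" for v w
    using left[of "K v + K w"] by (simp add: add right)
  have rmul': "K (v \<star> a) = K v \<star> a" for v a
    using left[of "K v \<star> a"] by (simp add: rmul right)
  obtain g' where g': "\<And>v. g' *v v = K v" using matrix_of_right_linear[of "K", OF add' rmul'] by blast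
  have "g ** g' = mat 1" "g' ** g = mat 1"
    unfolding matrix_eq by (simp_all add: g g' left right flip: matrix_vector_mul_assoc)
  then have "g \<in> carrier U_q" using form by (auto simp: U_q_def invertible_def g fun_eq_iff)
  then show thesis using that g by blast
qed

section \<open>The unitary group acting on boundary points and joins\<close>

lemma proj_act_rline: "proj_act g (rline v) = rline (g *v v)"
  by (simp add: proj_act_def rline_def image_image matrix_vector_rscale)

lemma U_q_inverse:
  assumes "g \<in> carrier U_q"
  obtains g' where "g' \<in> carrier U_q" "\<And>X. proj_act g' (proj_act g X) = X" "\<And>X. proj_act g (proj_act g' X) = X"
proof -
  interpret group "U_q :: 'a hmat monoid" by (rule group_U_q)
  have "inv\<^bsub>U_q\<^esub> g ** g = mat 1" "g ** inv\<^bsub>U_q\<^esub> g = mat 1"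
    using l_inv[OF assms] r_inv[OF assms] by (simp_all add: U_q_def)
  then have "proj_act (inv\<^bsub>U_q\<^esub> g) (proj_act g X) = X" "proj_act g (proj_act (inv\<^bsub>U_q\<^esub> g) X) = X" for X
    by (simp_all add: proj_act_def image_image matrix_vector_mul_assoc)
  then show thesis using that inv_closed[OF assms] by blast
qed

lemma proj_act_mult: "proj_act (g ** g') X = proj_act g (proj_act g' X)"
  by (simp add: proj_act_def image_image matrix_vector_mul_assoc)

lemma U_q_mult: "\<lbrakk>g \<in> carrier U_q; g' \<in> carrier U_q\<rbrakk> \<Longrightarrow> g ** g' \<in> carrier U_q"
  using group.is_monoid[OF group_U_q, THEN monoid.m_closed, of g g'] by (simp add: U_q_def)

lemma proj_act_boundary:
  assumes g: "g \<in> carrier U_q" and X: "X \<in> hyp_boundary"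
  shows "proj_act g X \<in> hyp_boundary"
proof -
  obtain v where v: "X = rline v" "v \<noteq> 0" "qform v = 0" using X by (auto simp: hyp_boundary_def)
  obtain g' where "g' ** g = mat 1" "qform (g *v v) = qform v"
    using g by (auto simp: U_q_def invertible_def fun_eq_iff)
  then have "g *v v \<noteq> 0" "qform (g *v v) = 0"
    using v by (auto simp: matrix_vector_mul_assoc dest: arg_cong[of _ _ "(*v) g'"])
  then show ?thesis unfolding v(1) proj_act_rline hyp_boundary_def by blast
qed

text \<open>Preservation of chains phrased through joins: for distinct \<open>X\<close> and
  \<open>Y\<close> the inclusion says that \<open>Z\<close> lies on the chain through them. This
  form translates directly into coordinates.\<close>

definition chain_iso :: "('m::finite hvec set \<Rightarrow> 'm hvec set) \<Rightarrow> bool" where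
  "chain_iso f \<longleftrightarrow> bij_betw f hyp_boundary hyp_boundary \<and>
    (\<forall>X\<in>hyp_boundary. \<forall>Y\<in>hyp_boundary. \<forall>Z\<in>hyp_boundary. X \<noteq> Y \<longrightarrow>
      (f Z \<subseteq> join_span (f X) (f Y) \<longleftrightarrow> Z \<subseteq> join_span X Y))"

text \<open>Linear maps carry joins to joins, and invertibility makes \<open>proj_act g\<close>
  reflect inclusions as well as preserve them.\<close>

lemma chain_iso_comp_proj_act:
  assumes f: "chain_iso f" and g: "g \<in> carrier U_q"
  shows "chain_iso (proj_act g \<circ> f)"
proof -
  obtain g' where g': "g' \<in> carrier U_q" "\<And>X. proj_act g' (proj_act g X) = X" "\<And>X. proj_act g (proj_act g' X) = X"
    using U_q_inverse[OF g] by blast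
  have "bij_betw (proj_act g) hyp_boundary hyp_boundary"
    by (rule bij_betw_byWitness[where f' = "proj_act g'"]) (use g' g proj_act_boundary in auto)
  then have "bij_betw (proj_act g \<circ> f) hyp_boundary hyp_boundary"
    using f by (auto simp: chain_iso_def intro: bij_betw_trans)
  moreover have "proj_act g Z \<subseteq> join_span (proj_act g X) (proj_act g Y) \<longleftrightarrow> Z \<subseteq> join_span X Y" for X Y Z
  proof -
    have "join_span (proj_act g X) (proj_act g Y) = proj_act g (join_span X Y)"
    proof -
      have "join_span (proj_act g X) (proj_act g Y) = {g *v s + g *v t | s t. s \<in> X \<and> t \<in> Y}"
        unfolding join_span_def proj_act_def by blast
      also have "\<dots> = proj_act g (join_span X Y)"
        unfolding join_span_def proj_act_def matrix_vector_right_distrib[symmetric] by blast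
      finally show ?thesis .
    qed
    moreover have "proj_act g A \<subseteq> proj_act g B \<longleftrightarrow> A \<subseteq> B" for A B
      using g'(2)[of A] g'(2)[of B] unfolding proj_act_def by (metis image_mono)
    ultimately show ?thesis by simp
  qed
  ultimately show ?thesis using f by (simp add: chain_iso_def)
qed

text \<open>Comparing first coordinates forces \<open>b = 1\<close>, while \<open>a\<close> is free:
  chains through infinity are the vertical fibres.\<close>

lemma fin_point_subset_join_inf:
  "fin_point y \<subseteq> join_span inf_point (fin_point x) \<longleftrightarrow> fst y = fst x"
proof -
  have "fin_point y \<subseteq> join_span inf_point (fin_point x) \<longleftrightarrow>
    (\<exists>a b. 1 = b \<and> fst y = fst x \<star> b \<and> snd y = a + snd x * b)"
    by (simp add: fin_point_def inf_point_def join_span_rline rline_subset_right_span2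
        mem_right_span2 hvec_rmul hvec_add)
  also have "\<dots> \<longleftrightarrow> fst y = fst x" by (auto intro: exI[of _ "snd y - snd x"])
  finally show ?thesis .
qed

lemma fin_point_subset_join_fin:
  "fin_point z \<subseteq> join_span (fin_point x) (fin_point y) \<longleftrightarrow> cochain x y z"
proof -
  have "fin_point z \<subseteq> join_span (fin_point x) (fin_point y) \<longleftrightarrow>
    (\<exists>a b. 1 = a + b \<and> fst z = fst x \<star> a + fst y \<star> b \<and> snd z = snd x * a + snd y * b)"
    by (simp add: fin_point_def join_span_rline rline_subset_right_span2
        mem_right_span2 hvec_rmul hvec_add)
  also have "\<dots> \<longleftrightarrow> (\<exists>b. fst z = fst x \<star> (1 - b) + fst y \<star> b \<and> snd z = snd x * (1 - b) + snd y * b)"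
    by (metis add_diff_cancel_right' diff_add_cancel)
  also have "\<dots> \<longleftrightarrow> cochain x y z"
    by (simp add: cochain_def rmul_distribs algebra_simps)
  finally show ?thesis .
qed

section \<open>Heisenberg translations and transitivity on the boundary\<close>

lemma bij_of_inverses: "\<lbrakk>\<And>x. k (h x) = x; \<And>x. h (k x) = x\<rbrakk> \<Longrightarrow> bij h"
  by (metis bijI injI surjI)

lemma herm_minus_left: "herm (- v) w = - herm v w"
  by (simp add: herm_def sum_negf)

lemma qcnj_herm: "qcnj (herm v w) = herm w v"
proof -
  have "qcnj (sum F A) = (\<Sum>i\<in>A. qcnj (F i))" if "finite A" for F and A :: "'a set"
    using that by (induction A) auto
  then show ?thesis by (simp add: herm_def)
qed

lemma herm_self: "herm v v = (norm v)\<^sup>2 *\<^sub>R 1"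
proof -
  have "qcnj (herm v v) = herm v v" by (rule qcnj_herm)
  then have "2 *\<^sub>R herm v v = (2 * qRe (herm v v)) *\<^sub>R 1"
    using qcnj_eq[of "herm v v"] by (metis diff_eq_eq scaleR_2)
  then have "2 *\<^sub>R herm v v = 2 *\<^sub>R (qRe (herm v v) *\<^sub>R 1)" by simp
  then have "herm v v = qRe (herm v v) *\<^sub>R 1" unfolding scaleR_cancel_left by simp
  then show ?thesis by (simp add: power2_norm_eq_inner inner_eq_qRe_herm)
qed

text \<open>A unipotent right linear map fixing infinity. It preserves \<open>qform\<close> when
  \<open>t + qcnj t\<close> is the squared norm of \<open>\<xi>\<close>, and its inverse then has
  the parameters \<open>- \<xi>\<close> and \<open>qcnj t\<close>.\<close>

definition heis_translation :: "quat ^ 'm \<Rightarrow> quat \<Rightarrow> 'm::finite hvec \<Rightarrow> 'm hvec" where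
  "heis_translation \<xi> t v = hvec (v $ First) ((\<chi> p. v $ Mid p) + \<xi> \<star> v $ First)
     (v $ Last + herm \<xi> (\<chi> p. v $ Mid p) + t * v $ First)"

lemma heis_translation_hvec:
  "heis_translation \<xi> t (hvec a \<zeta> c) = hvec a (\<zeta> + \<xi> \<star> a) (c + herm \<xi> \<zeta> + t * a)"
  by (simp add: heis_translation_def)

lemma translation_to_origin:
  assumes x: "x \<in> heis"
  obtains g where "g \<in> carrier U_q" "proj_act g inf_point = inf_point" "proj_act g (fin_point x) = fin_point (0, 0)"
proof -
  define \<xi> where "\<xi> = - fst x"
  \<comment> \<open>With this choice the last coordinate of the image of \<open>x\<close> is its
    trace minus the squared norm of \<open>fst x\<close>, which is 0 on \<open>heis\<close>.\<close>
  define t where "t = qcnj (snd x)"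
  have t: "(norm \<xi>)\<^sup>2 *\<^sub>R 1 = t + qcnj t"
    using x add_qcnj[of t] by (simp add: heis_def \<xi>_def t_def qtr_eq quat_eq_iff scaleR_quat_def one_quat_def)
  let ?T = "heis_translation \<xi> t" and ?T' = "heis_translation (- \<xi>) (qcnj t)"
  have comp: "heis_translation (- \<xi>) (qcnj t) (heis_translation \<xi> t v) = v"
    if "(norm \<xi>)\<^sup>2 *\<^sub>R 1 = t + qcnj t" for \<xi> :: "quat ^ 'a" and t v
  proof (cases v)
    case (1 a \<zeta> c)
    have "herm \<xi> \<xi> * a = t * a + qcnj t * a" using that by (simp add: herm_self flip: distrib_right)
    then show ?thesis by (simp add: 1 heis_translation_hvec herm_minus_left)
  qed
  have bij: "bij ?T"
    using comp[OF t] comp[of "- \<xi>" "qcnj t"] t by (intro bij_of_inverses[of ?T']) (simp_all add: add.commute)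
  have add: "?T (v + w) = ?T v + ?T w" for v w
    by (cases v; cases w) (simp add: hvec_add heis_translation_hvec rmul_add_right distrib_left)
  have rmul: "?T (v \<star> a) = ?T v \<star> a" for v a
    by (cases v) (simp add: hvec_rmul heis_translation_hvec rmul_add_left rmul_assoc distrib_right mult.assoc)
  have form: "qform (?T v) = qform v" for v
  proof (cases v)
    case (1 a \<zeta> c)
    have "qRe (qcnj a * herm \<xi> \<zeta>) = qRe (qcnj (qcnj a * herm \<xi> \<zeta>))" by (simp only: quat_sel_simps)
    also have "\<dots> = qRe (herm \<zeta> \<xi> * a)" by (simp add: qcnj_herm)
    finally have "qRe (qcnj a * herm \<xi> \<zeta>) = qRe (herm \<zeta> \<xi> * a)" .
    moreover have "2 * qRe (qcnj a * (t * a)) = (norm \<xi>)\<^sup>2 * (norm a)\<^sup>2"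
    proof -
      have "qRe (qcnj a * (t * a)) = qRe (t * (a * qcnj a))" by (metis qRe_mult_commute mult.assoc)
      also have "a * qcnj a = (norm a)\<^sup>2 *\<^sub>R 1" using qcnj_mult_self[of "qcnj a"] by simp
      finally show ?thesis using arg_cong[OF t, of qRe] by simp
    qed
    ultimately show ?thesis
      by (simp add: 1 heis_translation_hvec qform_hvec norm_add_rmul_sq distrib_left)
  qed
  obtain g where g: "g \<in> carrier U_q" "\<And>v. g *v v = ?T v"
    using U_q_of_right_linear[of ?T, OF add rmul bij form] by blast
  have "proj_act g inf_point = inf_point"
    by (simp add: inf_point_def proj_act_rline g heis_translation_hvec)
  moreover have "proj_act g (fin_point x) = fin_point (0, 0)"
  proof -
    have "snd x + herm \<xi> (fst x) + t = 0"
      using t by (simp add: \<xi>_def herm_minus_left herm_self) (simp add: t_def add.commute)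
    then show ?thesis by (simp add: fin_point_def proj_act_rline g heis_translation_hvec \<xi>_def)
  qed
  ultimately show thesis using that g(1) by blast
qed

lemma swap_origin_inf:
  obtains g :: "'m::finite hmat" where "g \<in> carrier U_q" "proj_act g (fin_point (0, 0)) = inf_point"
proof -
  define W :: "'m hvec \<Rightarrow> 'm hvec" where "W v = hvec (v $ Last) (\<chi> p. v $ Mid p) (v $ First)" for v
  have W: "W (hvec a \<zeta> c) = hvec c \<zeta> a" for a \<zeta> c by (simp add: W_def)
  have "W (W v) = v" for v by (cases v) (simp add: W)
  then have bij: "bij W" by (intro bij_of_inverses)
  have add: "W (v + w) = W v + W w" for v w by (cases v; cases w) (simp add: hvec_add W)
  have rmul: "W (v \<star> a) = W v \<star> a" for v a by (cases v) (simp add: hvec_rmul W)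
  have form: "qform (W v) = qform v" for v
  proof (cases v)
    case (1 a \<zeta> c)
    have "qRe (qcnj c * a) = qRe (qcnj (qcnj c * a))" by (simp only: quat_sel_simps)
    then show ?thesis by (simp add: 1 W qform_hvec)
  qed
  obtain g where g: "g \<in> carrier U_q" "\<And>v. g *v v = W v"
    using U_q_of_right_linear[of W, OF add rmul bij form] by blast
  have "proj_act g (fin_point (0, 0)) = inf_point"
    by (simp add: fin_point_def inf_point_def proj_act_rline g W)
  then show thesis using that g(1) by blast
qed

lemma transitive_to_inf:
  fixes X :: "'m::finite hvec set"
  assumes "X \<in> hyp_boundary"
  obtains g where "g \<in> carrier U_q" "proj_act g X = inf_point"
proof (cases "X = inf_point")
  case True
  have "(0, 0) \<in> (heis :: ((quat ^ 'm) \<times> quat) set)" by (simp add: heis_def)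
  then obtain g :: "'m hmat" where "g \<in> carrier U_q" "proj_act g inf_point = inf_point"
    using translation_to_origin by blast
  then show thesis using that True by blast
next
  case False
  then obtain x where x: "X = fin_point x" "x \<in> heis" using assms unfolding hyp_boundary_eq by blast
  obtain g where g: "g \<in> carrier U_q" "proj_act g X = fin_point (0, 0)"
    using translation_to_origin[OF x(2)] x(1) by metis
  obtain s :: "'m hmat" where s: "s \<in> carrier U_q" "proj_act s (fin_point (0, 0)) = inf_point"
    by (rule swap_origin_inf)
  show thesis using that[OF U_q_mult[OF s(1) g(1)]] g(2) s(2) by (simp add: proj_act_mult)
qed

text \<open>Fixing infinity lets \<open>f\<close> be read as a map \<open>h\<close> of
  \<open>heis\<close>; \<open>normal_form\<close> and the inner automorphism \<open>\<phi>\<close>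
  then yield an explicit unitary matrix.\<close>

lemma chain_iso_normalized:
  fixes f :: "'m::finite hvec set \<Rightarrow> 'm hvec set"
  assumes f: "chain_iso f" and f_inf: "f inf_point = inf_point" and f_zero: "f (fin_point (0, 0)) = fin_point (0, 0)"
  shows "\<exists>g\<in>carrier U_q. \<forall>X\<in>hyp_boundary. f X = proj_act g X"
proof -
  have bij: "bij_betw f hyp_boundary hyp_boundary" using f by (simp add: chain_iso_def)
  have bd: "inf_point \<in> hyp_boundary" "\<And>x. x \<in> heis \<Longrightarrow> fin_point x \<in> hyp_boundary"
    unfolding hyp_boundary_eq by simp_all
  have "\<exists>y. y \<in> heis \<and> f (fin_point x) = fin_point y" if x: "x \<in> heis" for x
  proof -
    have "f (fin_point x) \<noteq> inf_point"
      using bij f_inf bd(1) bd(2)[OF x] inf_point_neq_fin_point by (metis bij_betw_def inj_onD)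
    moreover have "f (fin_point x) \<in> hyp_boundary" using bij bd(2)[OF x] by (rule bij_betwE[rule_format])
    ultimately show ?thesis unfolding hyp_boundary_eq by blast
  qed
  then obtain h where h: "\<And>x. x \<in> heis \<Longrightarrow> h x \<in> heis \<and> f (fin_point x) = fin_point (h x)" by metis
  have span: "f Z \<subseteq> join_span (f X) (f Y) \<longleftrightarrow> Z \<subseteq> join_span X Y"
    if "X \<in> hyp_boundary" "Y \<in> hyp_boundary" "Z \<in> hyp_boundary" "X \<noteq> Y" for X Y Z
    using f that by (simp add: chain_iso_def)
  interpret heis_map h
  proof
    show "bij_betw h heis heis"
      unfolding bij_betw_def
    proof
      show "inj_on h heis"
      proof (rule inj_onI)
        fix x y assume xy: "x \<in> heis" "y \<in> heis" "h x = h y"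
        then have "f (fin_point x) = f (fin_point y)" using h by simp
        then have "fin_point x = fin_point y" using bij bd(2) xy by (metis bij_betw_def inj_onD)
        then show "x = y" by (simp add: fin_point_eq_iff)
      qed
      show "h ` heis = heis"
      proof
        show "h ` heis \<subseteq> heis" using h by blast
        show "heis \<subseteq> h ` heis"
        proof
          fix y assume y: "y \<in> (heis :: ((quat ^ 'm) \<times> quat) set)"
          then obtain X where X: "X \<in> hyp_boundary" "f X = fin_point y"
            using bij bd(2)[OF y] by (metis bij_betw_def imageE)
          then have "X \<noteq> inf_point" using f_inf inf_point_neq_fin_point by metis
          then obtain x where x: "x \<in> heis" "X = fin_point x" using X(1) unfolding hyp_boundary_eq by blast
          then have "fin_point (h x) = fin_point y" using h X(2) by metis
          then show "y \<in> h ` heis" using x(1) by (auto simp: fin_point_eq_iff)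
        qed
      qed
    qed
    show "fst (h x) = fst (h y) \<longleftrightarrow> fst x = fst y" if "x \<in> heis" "y \<in> heis" for x y
      using span[OF bd(1) bd(2) bd(2), OF that(2,1) inf_point_neq_fin_point] h that
      by (simp add: f_inf fin_point_subset_join_inf)
    show "cochain (h x) (h y) (h z) \<longleftrightarrow> cochain x y z"
      if "x \<in> heis" "y \<in> heis" "z \<in> heis" "fst x \<noteq> fst y" for x y z
    proof -
      have "fin_point x \<noteq> fin_point y" using that(4) by (auto simp: fin_point_eq_iff)
      from span[OF bd(2) bd(2) bd(2), OF that(1-3) this] show ?thesis
        using h that by (simp add: fin_point_subset_join_fin)
    qed
  qed
  have "(0, 0) \<in> (heis :: ((quat ^ 'm) \<times> quat) set)" by (simp add: heis_def)
  then have "fin_point (h (0, 0)) = fin_point (0, 0)" using h f_zero by metis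
  then have origin: "h (0, 0) = (0, 0)" by (simp only: fin_point_eq_iff)
  obtain k \<phi> where k: "0 < k" and \<phi>: "linear \<phi>" "\<phi> 1 = 1" "\<And>a b. \<phi> (a * b) = \<phi> a * \<phi> b"
    and h_eq: "\<And>x. x \<in> heis \<Longrightarrow> h x = (base (fst x), k\<^sup>2 *\<^sub>R \<phi> (snd x))"
    and base_add: "\<And>\<zeta> \<eta>. base (\<zeta> + \<eta>) = base \<zeta> + base \<eta>"
    and base_rmul: "\<And>\<zeta> b. base (\<zeta> \<star> b) = base \<zeta> \<star> \<phi> b"
    and base_norm: "\<And>\<zeta>. norm (base \<zeta>) = k * norm \<zeta>"
    using normal_form[OF origin] by blast
  obtain p where p: "p \<noteq> 0" "\<And>x. \<phi> x * p = p * x" using quat_automorphism_inner[OF \<phi>] by blast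
  \<comment> \<open>Without this factor the map \<open>L\<close> would multiply \<open>qform\<close>
    by \<open>k\<^sup>2 * (norm p)\<^sup>2\<close>. A real factor leaves the projective action
    unchanged.\<close>
  define r where "r = 1 / (k * norm p)"
  have r: "r \<noteq> 0" "r\<^sup>2 * (k\<^sup>2 * (norm p)\<^sup>2) = 1" using k p(1) by (simp_all add: r_def power_divide power_mult_distrib)
  \<comment> \<open>\<open>base\<close> is only semilinear; since
    \<open>\<phi> a * p = p * a\<close>, the factor \<open>p\<close> to its right turns it into a
    right linear map.\<close>
  define L :: "'m hvec \<Rightarrow> 'm hvec" where
    "L v = r *\<^sub>R hvec (p * v $ First) (base (\<chi> i. v $ Mid i) \<star> p) (k\<^sup>2 *\<^sub>R (p * v $ Last))" for v
  have scale_hvec: "s *\<^sub>R hvec a \<zeta> c = hvec (s *\<^sub>R a) (s *\<^sub>R \<zeta>) (s *\<^sub>R c)" for s a c and \<zeta> :: "quat ^ 'm"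
    by (rule hvec_eqI) simp_all
  have L: "L (hvec a \<zeta> c) = r *\<^sub>R hvec (p * a) (base \<zeta> \<star> p) (k\<^sup>2 *\<^sub>R (p * c))" for a \<zeta> c
    by (simp add: L_def)
  have add: "L (v + w) = L v + L w" for v w
    by (cases v; cases w) (simp add: hvec_add L base_add rmul_add_left distrib_left flip: scaleR_right_distrib)
  have rmul: "L (v \<star> a) = L v \<star> a" for v a
    by (cases v) (simp add: hvec_rmul L base_rmul rmul_assoc p(2) mult.assoc)
  have bijL: "bij L"
  proof (rule bijI)
    show "inj L"
    proof (rule injI)
      fix v w assume eq: "L v = L w"
      show "v = w"
      proof (cases v; cases w)
        fix a \<zeta> c a' \<zeta>' c' assume vw: "v = hvec a \<zeta> c" "w = hvec a' \<zeta>' c'"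
        have "base \<zeta> \<star> p = base \<zeta>' \<star> p" "p * a = p * a'" "p * c = p * c'"
          using eq r(1) k by (simp_all add: vw L)
        moreover have "base \<zeta> = base \<zeta>'" if "base \<zeta> \<star> p = base \<zeta>' \<star> p"
          using arg_cong[OF that, of "\<lambda>y. y \<star> inverse p"] p(1) by (simp add: rmul_assoc)
        ultimately show "v = w" using p(1) inj_base by (simp add: vw inj_eq)
      qed
    qed
    show "surj L"
      unfolding surj_def
    proof
      fix w
      show "\<exists>v. w = L v"
      proof (cases w)
        case (1 a \<zeta> c)
        obtain \<eta> where \<eta>: "base \<eta> = (1 / r) *\<^sub>R (\<zeta> \<star> inverse p)" using bij_base by (metis bij_pointE)
        have "w = L (hvec ((1 / r) *\<^sub>R (inverse p * a)) \<eta> ((1 / (r * k\<^sup>2)) *\<^sub>R (inverse p * c)))"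
          using r(1) k p(1) by (simp add: 1 L \<eta> scale_hvec rmul_assoc flip: mult.assoc)
        then show ?thesis by blast
      qed
    qed
  qed
  have form: "qform (L v) = qform v" for v
  proof (cases v)
    case (1 a \<zeta> c)
    have "qRe (qcnj (p * a) * (p * c)) = (norm p)\<^sup>2 * qRe (qcnj a * c)"
    proof -
      have "qcnj (p * a) * (p * c) = qcnj a * ((qcnj p * p) * c)" by (simp add: mult.assoc)
      then show ?thesis by (simp add: qcnj_mult_self)
    qed
    then have "qform (L v) = r\<^sup>2 * (k\<^sup>2 * (norm p)\<^sup>2) * qform v"
      by (simp add: 1 L scale_hvec qform_hvec norm_rmul base_norm power_mult_distrib algebra_simps power2_eq_square)
    then show ?thesis using r(2) by simp
  qed
  obtain g where g: "g \<in> carrier U_q" "\<And>v. g *v v = L v"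
    using U_q_of_right_linear[of L, OF add rmul bijL form] by blast
  have base_zero: "base 0 = 0" using base_norm[of 0] by simp
  have "f X = proj_act g X" if "X \<in> hyp_boundary" for X
  proof -
    from that consider "X = inf_point" | x where "X = fin_point x" "x \<in> heis"
      unfolding hyp_boundary_eq by blast
    then show ?thesis
    proof cases
      case 1
      have "L (hvec 0 0 1) = hvec 0 0 1 \<star> (r *\<^sub>R k\<^sup>2 *\<^sub>R p)"
        by (simp add: L base_zero hvec_rmul scale_hvec del: rmul_simps(6))
      moreover have "r *\<^sub>R k\<^sup>2 *\<^sub>R p \<noteq> 0" using r(1) k p(1) by simp
      ultimately have "proj_act g inf_point = inf_point"
        by (simp add: inf_point_def proj_act_rline g rline_rmul del: rmul_simps(6))
      then show ?thesis by (simp add: 1 f_inf)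
    next
      case 2
      \<comment> \<open>Moving \<open>p\<close> to the right through
        \<open>p * u = \<phi> u * p\<close> exhibits the result as a right multiple of the vector
        representing \<open>h x\<close>.\<close>
      have "L (hvec 1 (fst x) (snd x)) = hvec 1 (base (fst x)) (k\<^sup>2 *\<^sub>R \<phi> (snd x)) \<star> (r *\<^sub>R p)"
        by (simp add: L hvec_rmul scale_hvec p(2))
      moreover have "r *\<^sub>R p \<noteq> 0" using r(1) p(1) by simp
      ultimately show ?thesis using h[OF 2(2)] h_eq[OF 2(2)]
        by (simp add: 2(1) fin_point_def proj_act_rline g rline_rmul del: rmul_simps(6))
    qed
  qed
  then show ?thesis using g(1) by blast
qed

text \<open>First the image of infinity is moved back to infinity, then a translation fixing
  infinity moves the image of the origin back. \<open>descend\<close> undoes these two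
  normalizations.\<close>

lemma chain_iso_proj_act:
  fixes f :: "'m::finite hvec set \<Rightarrow> 'm hvec set"
  assumes f: "chain_iso f"
  shows "\<exists>g\<in>carrier U_q. \<forall>X\<in>hyp_boundary. f X = proj_act g X"
proof -
  have descend: "\<exists>g\<in>carrier U_q. \<forall>X\<in>hyp_boundary. f X = proj_act g X"
    if s: "s \<in> carrier U_q" and g: "\<exists>g\<in>carrier U_q. \<forall>X\<in>hyp_boundary. (proj_act s \<circ> f) X = proj_act g X"
    for s and f :: "'m hvec set \<Rightarrow> 'm hvec set"
  proof -
    obtain s' where s': "s' \<in> carrier U_q" "\<And>X. proj_act s' (proj_act s X) = X" using U_q_inverse[OF s] by metis
    obtain g where g: "g \<in> carrier U_q" "\<And>X. X \<in> hyp_boundary \<Longrightarrow> proj_act s (f X) = proj_act g X"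
      using g by auto
    have "f X = proj_act (s' ** g) X" if "X \<in> hyp_boundary" for X
      using s'(2)[of "f X"] g(2)[OF that] by (simp add: proj_act_mult)
    then show ?thesis using U_q_mult[OF s'(1) g(1)] by blast
  qed
  have bd: "inf_point \<in> hyp_boundary" "fin_point (0, 0) \<in> hyp_boundary"
    unfolding hyp_boundary_eq by (simp_all add: heis_def)
  have "f inf_point \<in> hyp_boundary" using f bd(1) by (auto simp: chain_iso_def bij_betw_def)
  then obtain s where s: "s \<in> carrier U_q" "proj_act s (f inf_point) = inf_point" by (rule transitive_to_inf)
  define f1 where "f1 = proj_act s \<circ> f"
  have f1: "chain_iso f1" "f1 inf_point = inf_point"
    using chain_iso_comp_proj_act[OF f s(1)] s(2) by (simp_all add: f1_def)
  have bij1: "bij_betw f1 hyp_boundary hyp_boundary" using f1(1) by (simp add: chain_iso_def)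
  then have "f1 (fin_point (0, 0)) \<in> hyp_boundary" using bd(2) by (rule bij_betwE[rule_format])
  moreover have "f1 (fin_point (0, 0)) \<noteq> inf_point"
    using bij1 bd f1(2) inf_point_neq_fin_point by (metis bij_betw_def inj_onD)
  ultimately obtain x where x: "x \<in> heis" "f1 (fin_point (0, 0)) = fin_point x"
    unfolding hyp_boundary_eq by blast
  obtain t where t: "t \<in> carrier U_q" "proj_act t inf_point = inf_point" "proj_act t (fin_point x) = fin_point (0, 0)"
    using translation_to_origin[OF x(1)] by blast
  have "\<exists>g\<in>carrier U_q. \<forall>X\<in>hyp_boundary. (proj_act t \<circ> f1) X = proj_act g X"
    by (rule chain_iso_normalized[OF chain_iso_comp_proj_act[OF f1(1) t(1)]]) (simp_all add: f1 t x)
  from descend[OF t(1) this] show ?thesis unfolding f1_def by (rule descend[OF s(1)])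
qed

theorem theorem3p3:
  fixes f :: "'m::finite hvec set \<Rightarrow> 'm hvec set"
  assumes "bij_betw f hyp_boundary hyp_boundary"
    and "\<And>C. chain C \<Longrightarrow> chain (f ` C)"
  shows "\<exists>\<gamma>\<in>carrier PU_q. \<forall>x\<in>hyp_boundary. f x = PU_act \<gamma> x"
proof -
  have "chain_iso f"
    using assms join_span_iff_of_chain_map[of f] by (simp add: chain_iso_def)
  then obtain g where g: "g \<in> carrier U_q" "\<And>X. X \<in> hyp_boundary \<Longrightarrow> f X = proj_act g X"
    using chain_iso_proj_act by blast
  have "{mat 1, - mat 1} #>\<^bsub>U_q\<^esub> g \<in> carrier PU_q"
    using g(1) by (auto simp: PU_q_def FactGroup_def RCOSETS_def)
  moreover have "\<forall>x\<in>hyp_boundary. f x = PU_act ({mat 1, - mat 1} #>\<^bsub>U_q\<^esub> g) x"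
    using g(2) hyp_boundary_subset_proj_space PU_act_coset by (metis subsetD)
  ultimately show ?thesis by blast
qed

end
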